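(* Let $k\ge 1$ and $N\ge 0$ be integers and let $t\ge 0$ be a real number (with $0^0=1$). The following randomized algorithm outputs a $k$-tiling of the rank-$N$ Aztec diamond, and each $k$-tiling $\boldsymbol T$ is output with probability proportional to its weight $\mathrm{wt}(\boldsymbol T)=t^{\#\text{interactions}(\boldsymbol T)}$. Algorithm. Start with the (empty) $k$-tiling of the rank-$0$ Aztec diamond. For $T=1,\dots,N$, pass from a $k$-tiling of rank $T-1$ to a $k$-tiling of rank $T$ as follows. 1. For each color independently, perform the slide-and-destroy step of the usual domino shuffle. For each color this gives a partial tiling of the rank-$T$ Aztec diamond whose uncovered region is a disjoint union of $2\times 2$ blocks (the "creation blocks" of that color). 2. Fill in the creation blocks, one color after another, from the smallest color to the largest; all creation blocks of a color are filled before passing to the next color. Given the configuration so far, each creation block of color $l$ is filled, independently of the other creation blocks of color $l$, with two horizontal dominoes with probability $$\frac{t^{\#_1(l)+\#_2(l)}}{1+t^{\#_1(l)+\#_2(l)}}$$ and with two vertical dominoes otherwise. Here, for the given block: - $\#_1(l)$ is the number of colors $m>l$ such that either the block is a creation block of color $m$ as well, or in color $m$ the lower-left square of the block is covered by the vertical domino occupying the lower-left and upper-left squares of the block, or by the horizontal domino occupying the lower-left and lower-right squares of the block; - $\#_2(l)$ is the number of colors $m<l$ such that in color $m$ the upper-right square of the block is covered by the horizontal domino occupying it and the square immediately to its right, or by the vertical domino occupying it and the square immediately above it. (For the smallest color $l=1$ one has $\#_2(1)=0$.) The output is the $k$-tiling obtained after the step $T=N$.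
   Context: Rank-$T$ Aztec diamond: the union of the unit squares of $\mathbb Z^2$ contained in $\{|x|+|y|\le T+1\}$ (for $T=0$ it is empty). Squares are labelled by their centers $(i,j)\in(\mathbb Z+\tfrac12)^2$; the square $(i,j)$ lies on diagonal $j-i+T\in\{0,\dots,2T\}$. In rank $T$, a square is white if its diagonal is odd and gray if its diagonal is even (so the color of a fixed square of the plane depends on the parity of $T$). A domino is a $2\times1$ or $1\times2$ rectangle made of two adjacent squares; a tiling covers every square of the diamond exactly once. $k$-tilings: a $k$-tiling is a $k$-tuple $\boldsymbol T=(T^{(1)},\dots,T^{(k)})$ of domino tilings of the same Aztec diamond; $T^{(a)}$ is said to have color $a$, and colors are ordered $1<2<\dots<k$. Interactions: for a white square $s$ and a color $a$, let $d_a(s)\in\{N,E,S,W\}$ be the direction (north/up, east/right, south/down, west/left) from $s$ to the other (gray) square of the domino of $T^{(a)}$ covering $s$. An interaction is a triple $(a,b,s)$ with colors $a<b$ and a white square $s$ such that $$(d_a(s),d_b(s))\in\{(E,E),(E,W),(E,N),(N,W)\}.$$ Types of dominoes (in a rank-$T$ diamond with its coloring): a horizontal domino is of type S if its left square is white and of type N if its left square is gray; a vertical domino is of type W if its bottom square is white and of type E if its bottom square is gray. Slide-and-destroy step from rank $T-1$ to rank $T$ (single color; types are determined by the rank-$(T-1)$ coloring, and both diamonds are centered at the origin): dominoes of type S, W, N, E slide one unit south, west, north, east respectively, and any two dominoes that cross each other's path as they slide are both deleted (that is, two dominoes forming a $2\times2$ block with a type S domino directly above a type N domino, or with a type E domino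 directly to the left of a type W domino). The remaining slid dominoes form a partial tiling of the rank-$T$ diamond, whose uncovered part is, in a unique way, a disjoint union of $2\times 2$ blocks; in the rank-$T$ coloring, the lower-left and upper-right squares of each such block are white. For $T=1$ the single creation block is the whole rank-$1$ diamond. *)

theory Defs
  imports Complex_Main "HOL-Library.FuncSet" "HOL-Library.Disjoint_Sets"
    "HOL-Probability.Product_PMF"
begin

section \<open>Aztec diamonds, dominoes and tilings\<close>

text \<open>
  A unit square of the lattice is represented by its lower-left corner \<open>(a, b)\<close>; its centre is
  \<open>(i, j) = (a + 1/2, b + 1/2)\<close>, so that \<open>j - i = b - a\<close>.
\<close>

type_synonym square = "int \<times> int"

definition unit_square :: "square \<Rightarrow> (real \<times> real) set" where
  "unit_square s =
     {of_int (fst s) .. of_int (fst s) + 1} \<times> {of_int (snd s) .. of_int (snd s) + 1}"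

definition aztec :: "nat \<Rightarrow> square set" where
  "aztec T = {s. unit_square s \<subseteq> {(x, y). \<bar>x\<bar> + \<bar>y\<bar> \<le> real T + 1}}"

definition white :: "nat \<Rightarrow> square \<Rightarrow> bool" where
  "white T s \<longleftrightarrow> odd (snd s - fst s + int T)"

datatype dir = North | East | South | West

fun move :: "dir \<Rightarrow> square \<Rightarrow> square" where
  "move North (a, b) = (a, b + 1)"
| "move East (a, b) = (a + 1, b)"
| "move South (a, b) = (a, b - 1)"
| "move West (a, b) = (a - 1, b)"

text \<open>
  \<open>Hor s\<close> is the horizontal domino with left square \<open>s\<close>, and \<open>Vert s\<close> is the vertical domino with
  bottom square \<open>s\<close>.
\<close>

datatype domino = Hor square | Vert square

fun cells :: "domino \<Rightarrow> square set" where
  "cells (Hor s) = {s, move East s}"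
| "cells (Vert s) = {s, move North s}"

definition tilings :: "nat \<Rightarrow> domino set set" where
  "tilings T = {D. (\<forall>d\<in>D. cells d \<subseteq> aztec T) \<and> (\<forall>s\<in>aztec T. \<exists>!d. d \<in> D \<and> s \<in> cells d)}"

text \<open>
  The colors are \<open>1, \<dots>, k\<close>. A \<open>k\<close>-tuple is a function on \<open>{1..k}\<close>, extended by \<open>undefined\<close>
  outside of this set so that equality of functions is equality of tuples.
\<close>

definition ktilings :: "nat \<Rightarrow> nat \<Rightarrow> (nat \<Rightarrow> domino set) set" where
  "ktilings k T = {1..k} \<rightarrow>\<^sub>E tilings T"


section \<open>Interactions and weights\<close>

definition direction :: "domino set \<Rightarrow> square \<Rightarrow> dir" where
  "direction D s = (THE r. \<exists>d\<in>D. cells d = {s, move r s})"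

definition interactions :: "nat \<Rightarrow> nat \<Rightarrow> (nat \<Rightarrow> domino set) \<Rightarrow> (nat \<times> nat \<times> square) set" where
  "interactions k T X =
     {(a, b, s). a \<in> {1..k} \<and> b \<in> {1..k} \<and> a < b \<and> s \<in> aztec T \<and> white T s \<and>
        (direction (X a) s, direction (X b) s)
          \<in> {(East, East), (East, West), (East, North), (North, West)}}"

definition wt :: "nat \<Rightarrow> nat \<Rightarrow> real \<Rightarrow> (nat \<Rightarrow> domino set) \<Rightarrow> real" where
  "wt k T t X = t ^ card (interactions k T X)"


section \<open>Slide and destroy\<close>

fun domino_type :: "nat \<Rightarrow> domino \<Rightarrow> dir" where
  "domino_type T (Hor s) = (if white T s then South else North)"
| "domino_type T (Vert s) = (if white T s then West else East)"

fun translate :: "dir \<Rightarrow> domino \<Rightarrow> domino" where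
  "translate r (Hor s) = Hor (move r s)"
| "translate r (Vert s) = Vert (move r s)"

definition crossing :: "nat \<Rightarrow> domino \<Rightarrow> domino \<Rightarrow> bool" where
  "crossing T d e \<longleftrightarrow>
     (\<exists>s. d = Hor (move North s) \<and> e = Hor s \<and> domino_type T d = South \<and> domino_type T e = North) \<or>
     (\<exists>s. d = Vert s \<and> e = Vert (move East s) \<and> domino_type T d = East \<and> domino_type T e = West)"

text \<open>Here \<open>T\<close> is the rank before the step; the result lives in the diamond of rank \<open>T + 1\<close>.\<close>

definition slide_destroy :: "nat \<Rightarrow> domino set \<Rightarrow> domino set" where
  "slide_destroy T D =
     (\<lambda>d. translate (domino_type T d) d) ` {d \<in> D. \<not> (\<exists>e\<in>D. crossing T d e \<or> crossing T e d)}"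


section \<open>Creation\<close>

definition upper_right :: "square \<Rightarrow> square" where
  "upper_right s = move East (move North s)"

definition block :: "square \<Rightarrow> square set" where
  "block s = {s, move East s, move North s, upper_right s}"

text \<open>
  The set of lower-left squares of the blocks that make up the part of the rank-\<open>T\<close> diamond not
  covered by the partial tiling \<open>P\<close>.
\<close>

definition creation_blocks :: "nat \<Rightarrow> domino set \<Rightarrow> square set" where
  "creation_blocks T P =
     (THE B. disjoint_family_on block B \<and> \<Union>(block ` B) = aztec T - \<Union>(cells ` P))"

text \<open>
  In the next three definitions \<open>X\<close> is the current configuration: the colors \<open>m < l\<close> have
  already been completed, and the colors \<open>m \<ge> l\<close> are still partial tilings.
\<close>

definition count1 :: "nat \<Rightarrow> nat \<Rightarrow> (nat \<Rightarrow> domino set) \<Rightarrow> nat \<Rightarrow> square \<Rightarrow> nat" where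
  "count1 k T X l s =
     card {m \<in> {1..k}. m > l \<and> (s \<in> creation_blocks T (X m) \<or> Vert s \<in> X m \<or> Hor s \<in> X m)}"

definition count2 :: "nat \<Rightarrow> (nat \<Rightarrow> domino set) \<Rightarrow> nat \<Rightarrow> square \<Rightarrow> nat" where
  "count2 k X l s =
     card {m \<in> {1..k}. m < l \<and> (Hor (upper_right s) \<in> X m \<or> Vert (upper_right s) \<in> X m)}"

definition fill_color ::
  "nat \<Rightarrow> real \<Rightarrow> nat \<Rightarrow> nat \<Rightarrow> (nat \<Rightarrow> domino set) \<Rightarrow> (nat \<Rightarrow> domino set) pmf" where
  "fill_color k t T l X =
     map_pmf
       (\<lambda>h. X(l := X l \<union>
          (\<Union>s\<in>creation_blocks T (X l).
             if h s then {Hor s, Hor (move North s)} else {Vert s, Vert (move East s)})))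
       (Pi_pmf (creation_blocks T (X l)) False
          (\<lambda>s. let n = count1 k T X l s + count2 k X l s in bernoulli_pmf (t ^ n / (1 + t ^ n))))"

primrec fill_colors ::
  "nat \<Rightarrow> real \<Rightarrow> nat \<Rightarrow> nat \<Rightarrow> (nat \<Rightarrow> domino set) \<Rightarrow> (nat \<Rightarrow> domino set) pmf" where
  "fill_colors k t T 0 X = return_pmf X"
| "fill_colors k t T (Suc l) X = bind_pmf (fill_colors k t T l X) (fill_color k t T (Suc l))"


section \<open>The shuffling algorithm\<close>

definition shuffle_step ::
  "nat \<Rightarrow> real \<Rightarrow> nat \<Rightarrow> (nat \<Rightarrow> domino set) \<Rightarrow> (nat \<Rightarrow> domino set) pmf" where
  "shuffle_step k t T X = fill_colors k t (Suc T) k (\<lambda>a\<in>{1..k}. slide_destroy T (X a))"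

primrec shuffle :: "nat \<Rightarrow> real \<Rightarrow> nat \<Rightarrow> (nat \<Rightarrow> domino set) pmf" where
  "shuffle k t 0 = return_pmf (\<lambda>a\<in>{1..k}. {})"
| "shuffle k t (Suc T) = bind_pmf (shuffle k t T) (shuffle_step k t T)"

end

theory Submission
  imports Defs
begin

text \<open>
  Let \<open>n = T + 1\<close>. The white coloring of rank \<open>n\<close> singles out the \<open>2 \<times> 2\<close> blocks with white lower-left and upper-right
  square that lie in the diamond of rank \<open>n\<close>. Every domino of a tiling of rank \<open>T\<close> or \<open>n\<close> lies in exactly one of them, and
  a shuffling step acts on each block separately: a single domino moves to the opposite side of its block, a full block (a pair of
  crossing dominoes) becomes empty, and an empty block is filled. In other words, the set of squares of the block that are covered from
  within the block is complemented (\<open>turn_covers\<close>). This describes which \<open>k\<close>-tilings \<open>X\<close> of rank \<open>T\<close> can be turned into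
  a given \<open>k\<close>-tiling \<open>Y\<close> of rank \<open>n\<close>: in each block and each color in which \<open>Y\<close> has an empty block, the orientation of the
  destroyed pair is free, and everything else is determined.

  The weights of both ranks are products over these blocks (\<open>wt_new\<close>, \<open>wt_old\<close>), and so is the probability of the step
  from \<open>X\<close> to \<open>Y\<close>, because the exponents \<open>#\<^sub>1 + #\<^sub>2\<close> depend only on \<open>Y\<close> (\<open>count_eq_exponent\<close>). The sum over \<open>X\<close> of the weight of
  \<open>X\<close> times the probability of the step from \<open>X\<close> to \<open>Y\<close> is therefore a product of local sums. At a single block, let
  \<open>H\<close> be the number of colors in which \<open>Y\<close> covers the lower-left square from within the block, \<open>G\<close> the number of
  colors in which it does not cover the upper-right square from within the block, and \<open>phi t m = (1 + t\<^sup>0) \<cdots> (1 + t\<^sup>m\<^sup>-\<^sup>1)\<close>. The two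
  orientations of a destroyed pair contribute a factor \<open>1 + t\<^sup>e\<close>, and the probability for a creation block has a
  denominator \<open>1 + t\<^sup>e\<close>. The exponents are such that the quotient of all these factors telescopes over the
  colors to \<open>phi t G / phi t H\<close> (\<open>phi_telescope\<close>), and the local sum is the local weight of \<open>Y\<close> times this quotient (\<open>local_balance\<close>).

  Finally, \<open>H\<close> and \<open>G\<close> both count the colors that point north or east from a white square, the lower-left square of the
  block for \<open>H\<close> and the upper-right square for \<open>G\<close>. In the product over all blocks the factors \<open>phi\<close> cancel except at the ends of the
  diagonals of white squares, where they are constants (\<open>phi_boundary\<close>). Hence a step maps a distribution
  proportional to the weights of rank \<open>T\<close> to one proportional to the weights of rank \<open>n\<close> (\<open>balance\<close>).
\<close>

section \<open>The diamond as a union of blocks\<close>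

lemma mem_aztec:
  "(a, b) \<in> aztec T \<longleftrightarrow> max (a + 1) (- a) + max (b + 1) (- b) \<le> int T + 1"
proof
  assume "(a, b) \<in> aztec T"
  then have sub: "\<bar>x\<bar> + \<bar>y\<bar> \<le> real T + 1"
    if "x \<in> {of_int a..of_int a + 1}" "y \<in> {of_int b..of_int b + 1}" for x y :: real
  proof -
    have "(x, y) \<in> unit_square (a, b)" using that by (simp add: unit_square_def)
    with \<open>(a, b) \<in> aztec T\<close> show ?thesis by (auto simp: aztec_def)
  qed
  \<comment> \<open>The condition need only be tested at the four corners, which have integer coordinates.\<close>
  have "\<bar>real_of_int x\<bar> + \<bar>real_of_int y\<bar> \<le> real T + 1" if "x \<in> {a, a + 1}" "y \<in> {b, b + 1}" for x y
    using that by (intro sub) auto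
  then have "\<bar>x\<bar> + \<bar>y\<bar> \<le> int T + 1" if "x \<in> {a, a + 1}" "y \<in> {b, b + 1}" for x y
    using that by (metis (mono_tags, lifting) of_int_abs of_int_add of_int_le_iff of_int_of_nat_eq of_int_1)
  from this[of a b] this[of "a+1" b] this[of a "b+1"] this[of "a+1" "b+1"]
  show "max (a + 1) (- a) + max (b + 1) (- b) \<le> int T + 1"
    by simp linarith
next
  assume *: "max (a + 1) (- a) + max (b + 1) (- b) \<le> int T + 1"
  have "real_of_int (max (a + 1) (- a) + max (b + 1) (- b)) \<le> real_of_int (int T + 1)"
    using * of_int_le_iff by blast
  then have "max (real_of_int a + 1) (- real_of_int a) + max (real_of_int b + 1) (- real_of_int b) \<le> real T + 1"
    by (simp add: of_int_max)
  then show "(a, b) \<in> aztec T"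
    by (auto simp: aztec_def unit_square_def)
qed

lemma finite_aztec [simp]: "finite (aztec T)"
proof (rule finite_subset)
  show "aztec T \<subseteq> {- int T - 1..int T} \<times> {- int T - 1..int T}"
    by (auto simp: mem_aztec)
qed auto

text \<open>
  These are the \<open>n\<^sup>2\<close> blocks that can be creation blocks of rank \<open>n\<close>, represented by their lower-left squares.
  Every domino of the plane lies in exactly one block whose lower-left square is white.
\<close>

definition blocks :: "nat \<Rightarrow> square set" where
  "blocks n = {v. white n v \<and> block v \<subseteq> aztec n}"

definition lower_left :: "square \<Rightarrow> square" where
  "lower_left s = move West (move South s)"

lemma mem_blocks:
  "(a, b) \<in> blocks (Suc T) \<longleftrightarrow> odd (b - a + int (Suc T)) \<and> \<bar>a + 1\<bar> + \<bar>b + 1\<bar> \<le> int T"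
proof -
  have "block (a, b) \<subseteq> aztec (Suc T) \<longleftrightarrow> \<bar>a + 1\<bar> + \<bar>b + 1\<bar> \<le> int T"
    by (simp add: block_def upper_right_def mem_aztec) linarith
  then show ?thesis by (simp add: blocks_def white_def)
qed

lemma finite_blocks [simp]: "finite (blocks n)"
  by (rule finite_subset[of _ "aztec n"]) (auto simp: blocks_def block_def)

lemma white_blocks: "v \<in> blocks n \<Longrightarrow> white n v"
  by (simp add: blocks_def)

text \<open>
  A square belongs to two blocks with white lower-left square; if it is white, it is the lower-left square
  of one and the upper-right square of the other. The diamond of rank \<open>T + 1\<close> is the union of the blocks, and the
  diamond of rank \<open>T\<close> consists of the squares that lie in two of them. The tilings of both ranks can
  therefore be described by the same blocks. In coordinates, the
  equivalences hold only up to a parity condition, which the witness \<open>k\<close> supplies; the rest is linear arithmetic.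
\<close>

lemma white_mem_aztec:
  assumes "white (Suc T) s"
  shows "s \<in> aztec T \<longleftrightarrow> s \<in> blocks (Suc T) \<and> lower_left s \<in> blocks (Suc T)"
    and "s \<in> aztec (Suc T) \<longleftrightarrow> s \<in> blocks (Suc T) \<or> lower_left s \<in> blocks (Suc T)"
proof -
  obtain a b where s: "s = (a, b)" by (cases s)
  with assms have odd: "odd (b - a + int (Suc T))" by (simp add: white_def)
  then have odd': "odd (b - 1 - (a - 1) + int (Suc T))" by simp
  obtain k where k: "int T = 2 * k + a - b"
    by (rule that[of "(b - a + int T) div 2"]) (use odd in presburger)
  have ball: "s \<in> blocks (Suc T) \<longleftrightarrow> \<bar>a + 1\<bar> + \<bar>b + 1\<bar> \<le> int T"
    and ball': "lower_left s \<in> blocks (Suc T) \<longleftrightarrow> \<bar>a\<bar> + \<bar>b\<bar> \<le> int T"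
    using odd odd' by (simp_all add: s lower_left_def mem_blocks)
  show "s \<in> aztec T \<longleftrightarrow> s \<in> blocks (Suc T) \<and> lower_left s \<in> blocks (Suc T)"
    unfolding ball ball' unfolding s mem_aztec using k by (smt (z3))
  show "s \<in> aztec (Suc T) \<longleftrightarrow> s \<in> blocks (Suc T) \<or> lower_left s \<in> blocks (Suc T)"
    unfolding ball ball' unfolding s mem_aztec of_nat_Suc using k by (smt (z3))
qed

text \<open>
  The same for gray squares, which are the upper-left square of one block and the lower-right square of
  another.
\<close>

lemma gray_mem_aztec:
  assumes "\<not> white (Suc T) s"
  shows "s \<in> aztec T \<longleftrightarrow> move South s \<in> blocks (Suc T) \<and> move West s \<in> blocks (Suc T)"
    and "s \<in> aztec (Suc T) \<longleftrightarrow> move South s \<in> blocks (Suc T) \<or> move West s \<in> blocks (Suc T)"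
proof -
  obtain a b where s: "s = (a, b)" by (cases s)
  with assms have ev: "even (b - a + int (Suc T))" by (simp add: white_def)
  then have odd: "odd (b - 1 - a + int (Suc T))" "odd (b - (a - 1) + int (Suc T))" by auto
  obtain k where k: "int T = 2 * k + a - b - 1"
    by (rule that[of "(b - a + int T + 1) div 2"]) (use ev in presburger)
  have ball: "move South s \<in> blocks (Suc T) \<longleftrightarrow> \<bar>a + 1\<bar> + \<bar>b\<bar> \<le> int T"
    and ball': "move West s \<in> blocks (Suc T) \<longleftrightarrow> \<bar>a\<bar> + \<bar>b + 1\<bar> \<le> int T"
    using odd by (simp_all add: s mem_blocks)
  show "s \<in> aztec T \<longleftrightarrow> move South s \<in> blocks (Suc T) \<and> move West s \<in> blocks (Suc T)"
    unfolding ball ball' unfolding s mem_aztec using k by (smt (z3))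
  show "s \<in> aztec (Suc T) \<longleftrightarrow> move South s \<in> blocks (Suc T) \<or> move West s \<in> blocks (Suc T)"
    unfolding ball ball' unfolding s mem_aztec of_nat_Suc using k by (smt (z3))
qed

section \<open>Local states of a block\<close>

text \<open>
  Squares stay atomic from here on, so that the simplifier computes with \<open>move\<close> and the corners of blocks and not with
  coordinates.
\<close>

declare split_paired_All [simp del] split_paired_Ex [simp del]

lemma move_inverse [simp]:
  "move South (move North s) = s" "move North (move South s) = s"
  "move East (move West s) = s" "move West (move East s) = s"
  by (cases s; simp)+

lemma corners [simp]:
  "lower_left (upper_right s) = s" "upper_right (lower_left s) = s"
  "move North (lower_left s) = move West s" "move East (lower_left s) = move South s"
  "lower_left (move North s) = move West s" "lower_left (move East s) = move South s"
  "move North (move East s) = upper_right s" "move East (move North s) = upper_right s"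
  "move South (upper_right s) = move East s" "move West (upper_right s) = move North s"
  by (cases s; simp add: lower_left_def upper_right_def)+

lemma white_move [simp]:
  "white n (move r s) \<longleftrightarrow> \<not> white n s"
  "white n (lower_left s) \<longleftrightarrow> white n s" "white n (upper_right s) \<longleftrightarrow> white n s"
  by (cases s; cases r; auto simp: white_def lower_left_def upper_right_def)+

lemma white_Suc [simp]: "white (Suc n) s \<longleftrightarrow> \<not> white n s"
  by (simp add: white_def)

lemma mem_cells:
  "s \<in> cells d \<longleftrightarrow> d = Hor s \<or> d = Hor (move West s) \<or> d = Vert s \<or> d = Vert (move South s)"
  by (cases d) (auto split: prod.splits)

lemma move_neq [simp]: "move r s \<noteq> s" "s \<noteq> move r s"
  by (cases r; cases s; simp)+

lemma move_eq_iff [simp]: "move r s = move r s' \<longleftrightarrow> s = s'"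
  by (cases r; cases s; cases s') auto

declare move.simps [simp del]

text \<open>
  The part of a tiling that lies in one block: no domino, a single domino at the bottom, top, left or right
  of the block, or two parallel dominoes that fill it.
\<close>

datatype local_state = Vacant | Bottom | Top | Left | Right | Rows | Columns

text \<open>
  For dominoes that do not overlap, the order of the case distinctions does not matter.
\<close>

definition state :: "domino set \<Rightarrow> square \<Rightarrow> local_state" where
  "state D v =
     (if Hor v \<in> D then if Hor (move North v) \<in> D then Rows else Bottom
      else if Hor (move North v) \<in> D then Top
      else if Vert v \<in> D then if Vert (move East v) \<in> D then Columns else Left
      else if Vert (move East v) \<in> D then Right else Vacant)"

fun parts :: "local_state \<Rightarrow> square \<Rightarrow> domino set" where
  "parts Vacant v = {}"
| "parts Bottom v = {Hor v}"
| "parts Top v = {Hor (move North v)}"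
| "parts Left v = {Vert v}"
| "parts Right v = {Vert (move East v)}"
| "parts Rows v = {Hor v, Hor (move North v)}"
| "parts Columns v = {Vert v, Vert (move East v)}"

definition assemble :: "nat \<Rightarrow> (square \<Rightarrow> local_state) \<Rightarrow> domino set" where
  "assemble n f = (\<Union>v\<in>blocks n. parts (f v) v)"

text \<open>
  The states in which the lower-left, upper-right, upper-left and lower-right square of the block is covered
  from within the block.
\<close>

definition ll :: "local_state set" where "ll = {Bottom, Left, Rows, Columns}"
definition ur :: "local_state set" where "ur = {Top, Right, Rows, Columns}"
definition ul :: "local_state set" where "ul = {Top, Left, Rows, Columns}"
definition lr :: "local_state set" where "lr = {Bottom, Right, Rows, Columns}"

lemmas covering_defs = ll_def ur_def ul_def lr_def

definition consistent :: "nat \<Rightarrow> domino set \<Rightarrow> bool" where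
  "consistent n D \<longleftrightarrow>
     (\<forall>v. white n v \<longrightarrow> Hor v \<in> D \<or> Hor (move North v) \<in> D \<longrightarrow>
        Vert v \<notin> D \<and> Vert (move East v) \<notin> D)"

lemma state_covers:
  assumes "consistent n D" "white n v"
  shows "state D v \<in> ll \<longleftrightarrow> Hor v \<in> D \<or> Vert v \<in> D"
    and "state D v \<in> ur \<longleftrightarrow> Hor (move North v) \<in> D \<or> Vert (move East v) \<in> D"
    and "state D v \<in> ul \<longleftrightarrow> Hor (move North v) \<in> D \<or> Vert v \<in> D"
    and "state D v \<in> lr \<longleftrightarrow> Hor v \<in> D \<or> Vert (move East v) \<in> D"
  using assms by (auto simp: consistent_def state_def covering_defs)

lemma ex1_of_four:
  assumes "distinct [p, q, r, u]"
  shows "(\<exists>!d. d \<in> D \<and> (d = p \<or> d = q \<or> d = r \<or> d = u)) \<longleftrightarrow>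
      (p \<in> D \<and> q \<notin> D \<and> r \<notin> D \<and> u \<notin> D) \<or> (p \<notin> D \<and> q \<in> D \<and> r \<notin> D \<and> u \<notin> D) \<or>
      (p \<notin> D \<and> q \<notin> D \<and> r \<in> D \<and> u \<notin> D) \<or> (p \<notin> D \<and> q \<notin> D \<and> r \<notin> D \<and> u \<in> D)"
  using assms by (cases "p \<in> D"; cases "q \<in> D"; cases "r \<in> D"; cases "u \<in> D") auto

text \<open>
  Each square of the diamond is in two blocks and must be covered from within exactly one of them. The coloring \<open>n\<close>
  that selects the blocks is independent of the rank \<open>R\<close>: it is used with \<open>n = R\<close> and with \<open>n = R + 1\<close>.
\<close>

lemma tilings_iff_state:
  "D \<in> tilings R \<longleftrightarrow>
     consistent n D \<and>
     (\<forall>s. white n s \<longrightarrow>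
        (if s \<in> aztec R then state D s \<in> ll \<longleftrightarrow> state D (lower_left s) \<notin> ur
         else state D s \<notin> ll \<and> state D (lower_left s) \<notin> ur)) \<and>
     (\<forall>s. \<not> white n s \<longrightarrow>
        (if s \<in> aztec R then state D (move South s) \<in> ul \<longleftrightarrow> state D (move West s) \<notin> lr
         else state D (move South s) \<notin> ul \<and> state D (move West s) \<notin> lr))"
    (is "_ \<longleftrightarrow> _ \<and> ?W \<and> ?G")
proof -
  let ?ex1 = "\<lambda>s. \<exists>!d. d \<in> D \<and> s \<in> cells d"
  let ?no = "\<lambda>s. \<forall>d\<in>D. s \<notin> cells d"
  have tile: "D \<in> tilings R \<longleftrightarrow> (\<forall>s. if s \<in> aztec R then ?ex1 s else ?no s)"
    by (auto simp: tilings_def)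
  have cons: "consistent n D" if "D \<in> tilings R"
    unfolding consistent_def
  proof (intro allI impI)
    fix v assume *: "white n v" "Hor v \<in> D \<or> Hor (move North v) \<in> D"
    have uniq: "d = e" if "d \<in> D" "e \<in> D" "s \<in> cells d" "s \<in> cells e" for d e s
      using that \<open>D \<in> tilings R\<close> unfolding tilings_def by blast
    show "Vert v \<notin> D \<and> Vert (move East v) \<notin> D"
      using * uniq[of "Hor v" "Vert v" v] uniq[of "Hor v" "Vert (move East v)" "move East v"]
        uniq[of "Hor (move North v)" "Vert v" "move North v"]
        uniq[of "Hor (move North v)" "Vert (move East v)" "upper_right v"]
      by auto
  qed
  \<comment> \<open>Only four dominoes cover a given square, two of them in each of its blocks.\<close>
  have four: "?ex1 s \<longleftrightarrow>
      (Hor s \<in> D \<and> Hor (move West s) \<notin> D \<and> Vert s \<notin> D \<and> Vert (move South s) \<notin> D) \<or>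
      (Hor s \<notin> D \<and> Hor (move West s) \<in> D \<and> Vert s \<notin> D \<and> Vert (move South s) \<notin> D) \<or>
      (Hor s \<notin> D \<and> Hor (move West s) \<notin> D \<and> Vert s \<in> D \<and> Vert (move South s) \<notin> D) \<or>
      (Hor s \<notin> D \<and> Hor (move West s) \<notin> D \<and> Vert s \<notin> D \<and> Vert (move South s) \<in> D)" for s
    unfolding mem_cells by (rule ex1_of_four) simp
  have none: "?no s \<longleftrightarrow> Hor s \<notin> D \<and> Hor (move West s) \<notin> D \<and> Vert s \<notin> D \<and> Vert (move South s) \<notin> D" for s
    unfolding mem_cells by blast
  have white_case: "(if s \<in> aztec R then ?ex1 s else ?no s) \<longleftrightarrow>
      (if s \<in> aztec R then state D s \<in> ll \<longleftrightarrow> state D (lower_left s) \<notin> ur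
         else state D s \<notin> ll \<and> state D (lower_left s) \<notin> ur)" if "consistent n D" "white n s" for s
  proof -
    have "\<not> (Hor s \<in> D \<and> Vert s \<in> D)" "\<not> (Hor (move West s) \<in> D \<and> Vert (move South s) \<in> D)"
      using that(1)[unfolded consistent_def, rule_format, of s]
        that(1)[unfolded consistent_def, rule_format, of "lower_left s"] that(2) by auto
    moreover have "state D s \<in> ll \<longleftrightarrow> Hor s \<in> D \<or> Vert s \<in> D"
      "state D (lower_left s) \<in> ur \<longleftrightarrow> Hor (move West s) \<in> D \<or> Vert (move South s) \<in> D"
      using state_covers(1)[OF that] state_covers(2)[OF that(1), of "lower_left s"] that(2) by simp_all
    ultimately show ?thesis
      unfolding four none by (simp split: if_splits) blast
  qed
  have gray_case: "(if s \<in> aztec R then ?ex1 s else ?no s) \<longleftrightarrow>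
      (if s \<in> aztec R then state D (move South s) \<in> ul \<longleftrightarrow> state D (move West s) \<notin> lr
         else state D (move South s) \<notin> ul \<and> state D (move West s) \<notin> lr)"
    if "consistent n D" "\<not> white n s" for s
  proof -
    have "\<not> (Hor s \<in> D \<and> Vert (move South s) \<in> D)" "\<not> (Hor (move West s) \<in> D \<and> Vert s \<in> D)"
      using that(1)[unfolded consistent_def, rule_format, of "move South s"]
        that(1)[unfolded consistent_def, rule_format, of "move West s"] that(2) by auto
    moreover have "state D (move South s) \<in> ul \<longleftrightarrow> Hor s \<in> D \<or> Vert (move South s) \<in> D"
      "state D (move West s) \<in> lr \<longleftrightarrow> Hor (move West s) \<in> D \<or> Vert s \<in> D"
      using state_covers(3)[OF that(1), of "move South s"] state_covers(4)[OF that(1), of "move West s"] that(2)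
      by simp_all
    ultimately show ?thesis
      unfolding four none by (simp split: if_splits) blast
  qed
  have by_color: "(\<forall>s. P s) \<longleftrightarrow> (\<forall>s. white n s \<longrightarrow> A s) \<and> (\<forall>s. \<not> white n s \<longrightarrow> B s)"
    if "\<And>s. white n s \<Longrightarrow> P s \<longleftrightarrow> A s" "\<And>s. \<not> white n s \<Longrightarrow> P s \<longleftrightarrow> B s" for P A B
    using that by blast
  show ?thesis
  proof (cases "consistent n D")
    case True
    then show ?thesis
      by (simp only: tile by_color[OF white_case[OF True] gray_case[OF True]] simp_thms)
  next
    case False
    with cons show ?thesis by blast
  qed
qed

lemma parts_disjoint:
  assumes "d \<in> parts x v" "d \<in> parts y w" "white n v" "white n w"
  shows "v = w"
  using assms by (cases x; cases y) (auto dest: arg_cong[of _ _ "white n"])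

lemma mem_assemble:
  assumes "white n v" "d \<in> {Hor v, Hor (move North v), Vert v, Vert (move East v)}"
  shows "d \<in> assemble n f \<longleftrightarrow> v \<in> blocks n \<and> d \<in> parts (f v) v"
proof -
  have "d \<in> parts Rows v \<or> d \<in> parts Columns v" using assms(2) by auto
  then have "w = v" if "w \<in> blocks n" "d \<in> parts (f w) w" for w
    using that assms(1) parts_disjoint white_blocks by blast
  then show ?thesis by (auto simp: assemble_def)
qed

lemma state_assemble:
  assumes "white n v"
  shows "state (assemble n f) v = (if v \<in> blocks n then f v else Vacant)"
  using mem_assemble[OF assms, of _ f] by (cases "f v") (auto simp: state_def)

lemma consistent_assemble: "consistent n (assemble n f)"
  unfolding consistent_def
proof (intro allI impI)
  fix v assume "white n v" "Hor v \<in> assemble n f \<or> Hor (move North v) \<in> assemble n f"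
  then show "Vert v \<notin> assemble n f \<and> Vert (move East v) \<notin> assemble n f"
    using mem_assemble[of n v _ f] by (cases "f v") auto
qed

lemma assemble_cong: "(\<And>v. v \<in> blocks n \<Longrightarrow> f v = g v) \<Longrightarrow> assemble n f = assemble n g"
  by (simp add: assemble_def)

lemma parts_state:
  assumes "consistent n D" "white n v"
  shows "parts (state D v) v = D \<inter> {Hor v, Hor (move North v), Vert v, Vert (move East v)}"
  using assms by (auto simp: consistent_def state_def)

section \<open>Turning blocks: the correspondence between consecutive ranks\<close>

text \<open>
  The possible states of a block after the step, given its state before: a single domino slides to the
  opposite side of its block, a pair of crossing dominoes disappears, and an empty block is filled in one of two ways. The
  relation is symmetric.
\<close>

fun turn :: "local_state \<Rightarrow> local_state set" where
  "turn Vacant = {Rows, Columns}"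
| "turn Bottom = {Top}"
| "turn Top = {Bottom}"
| "turn Left = {Right}"
| "turn Right = {Left}"
| "turn Rows = {Vacant}"
| "turn Columns = {Vacant}"

lemma finite_turn [simp]: "finite (turn x)"
  by (cases x) auto

lemma turn_sym: "y \<in> turn x \<longleftrightarrow> x \<in> turn y"
  by (cases x; cases y) auto

text \<open>
  Turning complements the set of squares that are covered from within the block. This is the reason
  why the step maps tilings to tilings.
\<close>

lemma turn_covers:
  assumes "y \<in> turn x"
  shows "y \<in> ll \<longleftrightarrow> x \<notin> ll" "y \<in> ur \<longleftrightarrow> x \<notin> ur" "y \<in> ul \<longleftrightarrow> x \<notin> ul" "y \<in> lr \<longleftrightarrow> x \<notin> lr"
  using assms by (cases x; auto simp: covering_defs)+

lemma aztec_mono: "aztec T \<subseteq> aztec (Suc T)"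
  by (auto simp: mem_aztec)

text \<open>
  Both squares of the domino lie in the diamond, but the block as a whole could stick out of it; that
  it does not is again a matter of parity.
\<close>

lemma domino_in_block:
  assumes "white (Suc T) v" "d \<in> {Hor v, Hor (move North v), Vert v, Vert (move East v)}"
    "cells d \<subseteq> aztec (Suc T)"
  shows "v \<in> blocks (Suc T)"
proof -
  obtain a b where v: "v = (a, b)" by (cases v)
  with assms(1) have odd: "odd (b - a + int (Suc T))" by (simp add: white_def)
  obtain k where k: "int T = 2 * k + a - b"
    by (rule that[of "(b - a + int T) div 2"]) (use odd in presburger)
  have "\<bar>a + 1\<bar> + \<bar>b + 1\<bar> \<le> int T"
    using assms(2,3) k unfolding v by (auto simp: mem_aztec move.simps) (smt (z3))+
  then show ?thesis using odd by (simp add: v mem_blocks)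
qed

lemma state_outside:
  assumes "D \<in> tilings R" "aztec R \<subseteq> aztec (Suc T)" "white (Suc T) v" "v \<notin> blocks (Suc T)"
  shows "state D v = Vacant"
proof (rule ccontr)
  assume "state D v \<noteq> Vacant"
  then obtain d where d: "d \<in> D" "d \<in> {Hor v, Hor (move North v), Vert v, Vert (move East v)}"
    by (auto simp: state_def split: if_splits)
  with assms(1,2) have "cells d \<subseteq> aztec (Suc T)"
    by (auto simp: tilings_def)
  with assms(3,4) d(2) domino_in_block show False by blast
qed

lemma home_block:
  obtains v where "white n v" "d \<in> {Hor v, Hor (move North v), Vert v, Vert (move East v)}"
proof (cases d)
  case (Hor s)
  show ?thesis
    using that[of s] that[of "move South s"] Hor by (cases "white n s") auto
next
  case (Vert s)
  show ?thesis
    using that[of s] that[of "move West s"] Vert by (cases "white n s") auto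
qed

lemma tilings_consistent: "D \<in> tilings R \<Longrightarrow> consistent n D"
  using tilings_iff_state by blast

lemma assemble_state:
  assumes "D \<in> tilings R" "aztec R \<subseteq> aztec (Suc T)"
  shows "assemble (Suc T) (state D) = D"
proof (rule set_eqI)
  fix d
  obtain v where v: "white (Suc T) v" "d \<in> {Hor v, Hor (move North v), Vert v, Vert (move East v)}"
    by (rule home_block)
  have "d \<in> D \<longleftrightarrow> d \<in> parts (state D v) v"
    using parts_state[OF tilings_consistent[OF assms(1)] v(1)] v(2) by blast
  moreover have "v \<in> blocks (Suc T)" if "d \<in> parts (state D v) v"
    using state_outside[OF assms v(1)] that by fastforce
  ultimately show "d \<in> assemble (Suc T) (state D) \<longleftrightarrow> d \<in> D"
    using mem_assemble[OF v] by blast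
qed

lemma tilings_white:
  assumes "D \<in> tilings R" "white n s"
  shows "if s \<in> aztec R then state D s \<in> ll \<longleftrightarrow> state D (lower_left s) \<notin> ur
     else state D s \<notin> ll \<and> state D (lower_left s) \<notin> ur"
  using assms tilings_iff_state[of D R n] by blast

lemma tilings_gray:
  assumes "D \<in> tilings R" "\<not> white n s"
  shows "if s \<in> aztec R then state D (move South s) \<in> ul \<longleftrightarrow> state D (move West s) \<notin> lr
     else state D (move South s) \<notin> ul \<and> state D (move West s) \<notin> lr"
  using assms tilings_iff_state[of D R n] by blast

lemma Vacant_covers [simp]: "Vacant \<notin> ll" "Vacant \<notin> ur" "Vacant \<notin> ul" "Vacant \<notin> lr"
  by (simp_all add: covering_defs)

text \<open>
  A square that is in two blocks is in both diamonds, and there "covered from exactly one block" is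
  preserved by complementation. A square that is in one block only is in the larger diamond but not in the smaller one; it
  is covered from that block in the larger rank exactly if it is not covered in the smaller rank. The same argument works in both
  directions, from rank \<open>T\<close> to rank \<open>T + 1\<close> and back.
\<close>

lemma assemble_turn_tilings:
  assumes "D \<in> tilings R" "R = T \<and> R' = Suc T \<or> R = Suc T \<and> R' = T"
    "\<And>v. v \<in> blocks (Suc T) \<Longrightarrow> f v \<in> turn (state D v)"
  shows "assemble (Suc T) f \<in> tilings R'"
proof -
  let ?E = "assemble (Suc T) f"
  have vacant: "state D v = Vacant" if "white (Suc T) v" "v \<notin> blocks (Suc T)" for v
    by (rule state_outside[OF assms(1) _ that]) (use assms(2) aztec_mono in auto)
  have covers: "v \<in> blocks (Suc T) \<Longrightarrow> f v \<in> ll \<longleftrightarrow> state D v \<notin> ll"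
    "v \<in> blocks (Suc T) \<Longrightarrow> f v \<in> ur \<longleftrightarrow> state D v \<notin> ur"
    "v \<in> blocks (Suc T) \<Longrightarrow> f v \<in> ul \<longleftrightarrow> state D v \<notin> ul"
    "v \<in> blocks (Suc T) \<Longrightarrow> f v \<in> lr \<longleftrightarrow> state D v \<notin> lr" for v
    using turn_covers[OF assms(3)] by blast+
  show ?thesis
    unfolding tilings_iff_state[of ?E R' "Suc T"]
  proof (intro conjI allI impI)
    fix s assume s: "white (Suc T) s"
    then have w: "white (Suc T) (lower_left s)" by simp
    show "if s \<in> aztec R' then (state ?E s \<in> ll) = (state ?E (lower_left s) \<notin> ur)
         else state ?E s \<notin> ll \<and> state ?E (lower_left s) \<notin> ur"
      using assms(2) tilings_white[OF assms(1) s]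
      unfolding state_assemble[OF s] state_assemble[OF w]
      by (elim disjE conjE; hypsubst; unfold white_mem_aztec[OF s];
          cases "s \<in> blocks (Suc T)"; cases "lower_left s \<in> blocks (Suc T)";
          simp add: vacant[OF s] vacant[OF w] covers)
  next
    fix s assume s: "\<not> white (Suc T) s"
    then have w: "white (Suc T) (move South s)" "white (Suc T) (move West s)" by simp_all
    show "if s \<in> aztec R' then (state ?E (move South s) \<in> ul) = (state ?E (move West s) \<notin> lr)
         else state ?E (move South s) \<notin> ul \<and> state ?E (move West s) \<notin> lr"
      using assms(2) tilings_gray[OF assms(1) s]
      unfolding state_assemble[OF w(1)] state_assemble[OF w(2)]
      by (elim disjE conjE; hypsubst; unfold gray_mem_aztec[OF s];
          cases "move South s \<in> blocks (Suc T)"; cases "move West s \<in> blocks (Suc T)";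
          simp add: vacant[OF w(1)] vacant[OF w(2)] covers)
  qed (rule consistent_assemble)
qed

section \<open>Slide, destroy and create within the blocks\<close>

fun slid :: "local_state \<Rightarrow> local_state" where
  "slid Bottom = Top"
| "slid Top = Bottom"
| "slid Left = Right"
| "slid Right = Left"
| "slid _ = Vacant"

text \<open>
  The colors of rank \<open>T\<close> make crossing dominoes a pair in one block of rank \<open>T + 1\<close>.
\<close>

lemma crossing_iff:
  "crossing T d e \<longleftrightarrow>
     (\<exists>v. white (Suc T) v \<and> (d = Hor (move North v) \<and> e = Hor v \<or> d = Vert v \<and> e = Vert (move East v)))"
  by (auto simp: crossing_def)

text \<open>
  Sliding moves a domino to the opposite side of its block, so the step acts on each block separately.
\<close>

lemma slide_destroy_eq:
  assumes "D \<in> tilings T"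
  shows "slide_destroy T D = assemble (Suc T) (slid \<circ> state D)"
proof (rule set_eqI)
  fix x
  note cons = tilings_consistent[OF assms, of "Suc T"]
  have home: "d \<in> parts (state D v) v" if "d \<in> D" "white (Suc T) v"
    "d \<in> {Hor v, Hor (move North v), Vert v, Vert (move East v)}" for d v
    using parts_state[OF cons that(2)] that(1,3) by blast
  have orig: "d \<in> D" if "white (Suc T) v" "d \<in> parts (state D v) v" for d v
    using parts_state[OF cons that(1)] that(2) by blast
  show "x \<in> slide_destroy T D \<longleftrightarrow> x \<in> assemble (Suc T) (slid \<circ> state D)"
  proof
    assume "x \<in> slide_destroy T D"
    then obtain d where d: "d \<in> D" "\<And>e. e \<in> D \<Longrightarrow> \<not> crossing T d e \<and> \<not> crossing T e d"
      and x: "x = translate (domino_type T d) d"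
      by (auto simp: slide_destroy_def)
    obtain v where v: "white (Suc T) v" "d \<in> {Hor v, Hor (move North v), Vert v, Vert (move East v)}"
      by (rule home_block)
    have dv: "d \<in> parts (state D v) v" by (rule home[OF d(1) v])
    have vb: "v \<in> blocks (Suc T)"
      using state_outside[OF assms aztec_mono v(1)] dv by fastforce
    have "x \<in> parts (slid (state D v)) v"
    proof (cases "state D v")
      case Rows
      then have "Hor v \<in> D" "Hor (move North v) \<in> D" using orig[OF v(1)] by auto
      with d(2) v(1) dv Rows show ?thesis by (auto simp: crossing_iff)
    next
      case Columns
      then have "Vert v \<in> D" "Vert (move East v) \<in> D" using orig[OF v(1)] by auto
      with d(2) v(1) dv Columns show ?thesis by (auto simp: crossing_iff)
    qed (use dv v(1) x in auto)
    with vb show "x \<in> assemble (Suc T) (slid \<circ> state D)" by (auto simp: assemble_def)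
  next
    assume "x \<in> assemble (Suc T) (slid \<circ> state D)"
    then obtain v where v: "v \<in> blocks (Suc T)" "x \<in> parts (slid (state D v)) v"
      by (auto simp: assemble_def)
    have w: "white (Suc T) v" using v(1) by (rule white_blocks)
    obtain d where d: "parts (state D v) v = {d}" "x = translate (domino_type T d) d"
      using v(2) w by (cases "state D v") auto
    have "d \<in> D" using orig[OF w] d(1) by blast
    moreover have False if e: "e \<in> D" "crossing T d e \<or> crossing T e d" for e
    proof -
      let ?pair = "\<lambda>u d e. d = Hor (move North u) \<and> e = Hor u \<or> d = Vert u \<and> e = Vert (move East u)"
      obtain u where u: "white (Suc T) u" "?pair u d e \<or> ?pair u e d"
        using e(2) unfolding crossing_iff by metis
      have du: "d \<in> parts (state D u) u"
        by (rule home[OF \<open>d \<in> D\<close> u(1)]) (use u(2) in auto)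
      have eu: "e \<in> parts (state D u) u"
        by (rule home[OF \<open>e \<in> D\<close> u(1)]) (use u(2) in auto)
      have "u = v"
        by (rule parts_disjoint[OF du _ u(1) w, of "state D v"]) (simp add: d(1))
      with eu have "d = e" using d(1) by simp
      with u(2) show False by auto
    qed
    ultimately have "d \<in> {d \<in> D. \<not> (\<exists>e\<in>D. crossing T d e \<or> crossing T e d)}"
      by blast
    then show "x \<in> slide_destroy T D"
      unfolding slide_destroy_def d(2) by (rule imageI)
  qed
qed

text \<open>
  Take a block that belongs to only one of the two families, with lower-left square \<open>s\<close> as far to the lower left as
  possible. In the other family \<open>s\<close> is covered by a block that starts further to the lower left; by minimality this block
  is in both families, where it overlaps the first one.
\<close>

lemma block_decomposition_unique:
  assumes "disjoint_family_on block A" "disjoint_family_on block B"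
    "\<Union>(block ` A) = \<Union>(block ` B)" "finite (\<Union>(block ` A))"
  shows "A = B"
proof (rule ccontr)
  assume "A \<noteq> B"
  have self: "s \<in> block s" for s by (simp add: block_def)
  define S where "S = (A - B) \<union> (B - A)"
  have "S \<noteq> {}" using \<open>A \<noteq> B\<close> by (auto simp: S_def)
  moreover have "finite S"
  proof (rule finite_subset[OF _ assms(4)], rule subsetI)
    fix s assume "s \<in> S"
    then consider "s \<in> A" | "s \<in> B" by (auto simp: S_def)
    then show "s \<in> \<Union>(block ` A)"
      by cases (use self assms(3) in \<open>metis UN_I\<close>)+
  qed
  ultimately obtain s where s: "s \<in> S" and min: "\<And>u. u \<in> S \<Longrightarrow> fst s + snd s \<le> fst u + snd u"
    using ex_min_if_finite[of "(\<lambda>u. fst u + snd u) ` S"] by (fastforce simp: not_less)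
  have contra: False
    if *: "disjoint_family_on block A" "\<Union>(block ` A) = \<Union>(block ` B)" "s \<in> A" "s \<notin> B" "(A - B) \<union> (B - A) = S"
    for A B
  proof -
    have "s \<in> \<Union>(block ` B)"
      unfolding *(2)[symmetric] using *(3) self by (rule UN_I)
    then obtain u where u: "u \<in> B" "s \<in> block u" by blast
    have "fst u + snd u < fst s + snd s"
      using u *(4) by (cases u) (auto simp: block_def upper_right_def move.simps)
    with min[of u] have "u \<notin> S" by linarith
    then have "u \<in> A" using u(1) unfolding *(5)[symmetric] by simp
    moreover have "u \<noteq> s" using u(1) *(4) by blast
    ultimately have "block u \<inter> block s = {}"
      using *(1,3) by (auto dest: disjoint_family_onD)
    with u(2) self[of s] show False by blast
  qed
  from s consider "s \<in> A" "s \<notin> B" | "s \<in> B" "s \<notin> A" by (auto simp: S_def)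
  then show False
    proof cases
    case 1
    then show False by (rule contra[OF assms(1,3)]) (simp add: S_def)
  next
    case 2
    then show False by (rule contra[OF assms(2) assms(3)[symmetric]]) (auto simp: S_def)
  qed
qed

lemma mem_block_iff: "s \<in> block v \<longleftrightarrow> v = s \<or> v = lower_left s \<or> v = move South s \<or> v = move West s"
  by (cases s; cases v) (auto simp: block_def lower_left_def upper_right_def move.simps)

lemma mem_cells_assemble:
  "s \<in> \<Union>(cells ` assemble n f) \<longleftrightarrow>
    (if white n s then state (assemble n f) s \<in> ll \<or> state (assemble n f) (lower_left s) \<in> ur
     else state (assemble n f) (move South s) \<in> ul \<or> state (assemble n f) (move West s) \<in> lr)"
proof -
  have "s \<in> \<Union>(cells ` assemble n f) \<longleftrightarrow> Hor s \<in> assemble n f \<or> Hor (move West s) \<in> assemble n f \<or>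
      Vert s \<in> assemble n f \<or> Vert (move South s) \<in> assemble n f"
    unfolding UN_iff mem_cells by blast
  also have "\<dots> \<longleftrightarrow> (if white n s then state (assemble n f) s \<in> ll \<or> state (assemble n f) (lower_left s) \<in> ur
     else state (assemble n f) (move South s) \<in> ul \<or> state (assemble n f) (move West s) \<in> lr)"
    using state_covers[OF consistent_assemble, of n s f] state_covers[OF consistent_assemble, of n "lower_left s" f]
      state_covers[OF consistent_assemble, of n "move South s" f] state_covers[OF consistent_assemble, of n "move West s" f]
    by auto
  finally show ?thesis .
qed

lemma slid_covers:
  assumes "x \<noteq> Vacant"
  shows "slid x \<in> ll \<longleftrightarrow> x \<notin> ll" "slid x \<in> ur \<longleftrightarrow> x \<notin> ur" "slid x \<in> ul \<longleftrightarrow> x \<notin> ul" "slid x \<in> lr \<longleftrightarrow> x \<notin> lr"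
  using assms by (cases x; auto simp: covering_defs)+

text \<open>
  The blocks that were empty before the step are disjoint, since a square in two of them would have been uncovered
  in rank \<open>T\<close>; and they make up the uncovered region.
\<close>

lemma creation_blocks_slide:
  assumes "D \<in> tilings T"
  shows "creation_blocks (Suc T) (slide_destroy T D) = {v \<in> blocks (Suc T). state D v = Vacant}"
proof -
  let ?n = "Suc T" and ?C = "{v \<in> blocks (Suc T). state D v = Vacant}"
  have slid: "slid x \<in> S \<longleftrightarrow> x \<noteq> Vacant \<and> x \<notin> S" if "S \<in> {ll, ur, ul, lr}" for x S
    using that slid_covers[of x] by (cases "x = Vacant") auto
  have disj: "disjoint_family_on block ?C"
    unfolding disjoint_family_on_def
  proof (intro ballI impI, rule ccontr)
    fix u v assume uv: "u \<in> ?C" "v \<in> ?C" "u \<noteq> v" "block u \<inter> block v \<noteq> {}"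
    then obtain s where s: "s \<in> block u" "s \<in> block v" by blast
    have w: "white ?n u" "white ?n v" using uv(1,2) white_blocks[of u ?n] white_blocks[of v ?n] by simp_all
    show False
    proof (cases "white ?n s")
      case True
      with s w have "{u, v} \<subseteq> {s, lower_left s}" by (auto simp: mem_block_iff)
      with uv(3) have "{s, lower_left s} = {u, v}" by auto
      with uv(1,2) have "{s, lower_left s} \<subseteq> ?C" by simp
      then have *: "s \<in> ?C" "lower_left s \<in> ?C" by simp_all
      then have "s \<in> aztec T" using white_mem_aztec(1)[OF True] by simp
      with tilings_white[OF assms True] * show False by simp
    next
      case False
      with s w have "{u, v} \<subseteq> {move South s, move West s}" by (auto simp: mem_block_iff)
      with uv(3) have "{move South s, move West s} = {u, v}" by auto
      with uv(1,2) have "{move South s, move West s} \<subseteq> ?C" by simp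
      then have *: "move South s \<in> ?C" "move West s \<in> ?C" by simp_all
      then have "s \<in> aztec T" using gray_mem_aztec(1)[OF False] by simp
      with tilings_gray[OF assms False] * show False by simp
    qed
  qed
  have union: "\<Union>(block ` ?C) = aztec ?n - \<Union>(cells ` slide_destroy T D)"
  proof (rule set_eqI)
    fix s
    show "s \<in> \<Union>(block ` ?C) \<longleftrightarrow> s \<in> aztec ?n - \<Union>(cells ` slide_destroy T D)"
    proof (cases "white ?n s")
      case True
      then have w: "white ?n (lower_left s)" by simp
      have "s \<in> \<Union>(block ` ?C) \<longleftrightarrow> s \<in> ?C \<or> lower_left s \<in> ?C"
        using True white_blocks by (fastforce simp: mem_block_iff)
      then show ?thesis
        unfolding slide_destroy_eq[OF assms] Diff_iff mem_cells_assemble state_assemble[OF True] state_assemble[OF w]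
        using True tilings_white[OF assms True] unfolding white_mem_aztec[OF True]
        by (cases "s \<in> blocks ?n"; cases "lower_left s \<in> blocks ?n";
            cases "state D s = Vacant"; cases "state D (lower_left s) = Vacant"; simp add: slid)
    next
      case False
      then have w: "white ?n (move South s)" "white ?n (move West s)" by simp_all
      have "s \<in> \<Union>(block ` ?C) \<longleftrightarrow> move South s \<in> ?C \<or> move West s \<in> ?C"
        using False white_blocks by (fastforce simp: mem_block_iff)
      then show ?thesis
        unfolding slide_destroy_eq[OF assms] Diff_iff mem_cells_assemble state_assemble[OF w(1)] state_assemble[OF w(2)]
        using False tilings_gray[OF assms False] unfolding gray_mem_aztec[OF False]
        by (cases "move South s \<in> blocks ?n"; cases "move West s \<in> blocks ?n";
            cases "state D (move South s) = Vacant"; cases "state D (move West s) = Vacant"; simp add: slid)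
    qed
  qed
  show ?thesis
    unfolding creation_blocks_def
  proof (rule the_equality)
    show "disjoint_family_on block ?C \<and> \<Union>(block ` ?C) = aztec ?n - \<Union>(cells ` slide_destroy T D)"
      using disj union by blast
  next
    fix B assume B: "disjoint_family_on block B \<and> \<Union>(block ` B) = aztec ?n - \<Union>(cells ` slide_destroy T D)"
    then have eq: "\<Union>(block ` B) = \<Union>(block ` ?C)" and "finite (\<Union>(block ` B))"
      using union by simp_all
    then show "B = ?C"
      using block_decomposition_unique[OF conjunct1[OF B] disj] by blast
  qed
qed

section \<open>The identity at a single block\<close>

text \<open>
  The contribution of a block to the number of interactions of two colors \<open>a < b\<close> that have the
  states \<open>x\<close> and \<open>y\<close> in it. In rank \<open>T + 1\<close> (\<open>new\<close>) the white squares of the block are the lower-left and the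
  upper-right one. The types \<open>(E,E)\<close> and \<open>(E,N)\<close> are counted at the block of which the white square is the
  lower-left square, and \<open>(E,W)\<close> and \<open>(N,W)\<close> at the block of which it is the upper-right square; there, that
  color \<open>a\<close> points east or north means that it does not cover the square from within the block. In rank \<open>T\<close> (\<open>old\<close>) the white
  squares are the upper-left one, where \<open>(E,E)\<close>, \<open>(E,W)\<close> and \<open>(E,N)\<close> are counted, and the lower-right one,
  where \<open>(N,W)\<close> is counted.
\<close>

definition energy_new :: "local_state \<Rightarrow> local_state \<Rightarrow> nat" where
  "energy_new x y = of_bool (x \<in> {Bottom, Rows} \<and> y \<in> ll) + of_bool (x \<notin> ur \<and> y \<in> {Top, Rows})"

definition energy_old :: "local_state \<Rightarrow> local_state \<Rightarrow> nat" where
  "energy_old x y =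
     of_bool (x \<in> {Top, Rows} \<and> y \<notin> {Left, Columns}) + of_bool (x \<in> {Right, Columns} \<and> y \<in> {Bottom, Rows})"

text \<open>
  The part that both ranks have in common. Each of the remaining terms depends on the orientation of
  the created or destroyed pair in one color only, and so the choices made for different colors decouple.
\<close>

definition energy_core :: "local_state \<Rightarrow> local_state \<Rightarrow> nat" where
  "energy_core x y = of_bool (x = Bottom \<and> y \<in> ll) + of_bool (x \<notin> ur \<and> y = Top)"

lemma energy_new_core:
  "energy_new x y = energy_core x y + of_bool (x = Rows \<and> y \<in> ll) + of_bool (x \<notin> ur \<and> y = Rows)"
  by (cases x; cases y) (auto simp: energy_new_def energy_core_def covering_defs)

lemma energy_old_core:
  assumes "x' \<in> turn x" "y' \<in> turn y"
  shows "energy_old x' y' =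
    energy_core x y + of_bool (x' = Rows \<and> y \<in> ll) + of_bool (x \<notin> ur \<and> y' = Rows)"
  using assms by (cases x; cases y) (auto simp: energy_old_def energy_core_def covering_defs)

definition pair_sum :: "nat \<Rightarrow> (nat \<Rightarrow> nat \<Rightarrow> nat) \<Rightarrow> nat" where
  "pair_sum k h = (\<Sum>a\<in>{1..k}. \<Sum>b\<in>{1..k}. if a < b then h a b else 0)"

text \<open>
  For a color that fills the block this is the exponent \<open>#\<^sub>1 + #\<^sub>2\<close> of the algorithm. For a color in which the block
  has become empty, it is the exponent that weighs the two possibilities for the destroyed pair.
\<close>

definition exponent :: "nat \<Rightarrow> (nat \<Rightarrow> local_state) \<Rightarrow> nat \<Rightarrow> nat" where
  "exponent k y l = card {m \<in> {1..k}. m > l \<and> y m \<in> ll} + card {m \<in> {1..k}. m < l \<and> y m \<notin> ur}"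

lemma pair_sum_rows:
  "pair_sum k (\<lambda>a b. of_bool (f a = Rows \<and> y b \<in> ll) + of_bool (y a \<notin> ur \<and> f b = Rows)) =
   (\<Sum>l\<in>{1..k}. if f l = Rows then exponent k y l else 0)"
proof -
  have card_ll: "card {m \<in> {1..k}. m > l \<and> y m \<in> ll} = (\<Sum>m\<in>{1..k}. of_bool (l < m \<and> y m \<in> ll))" for l
    by (simp add: sum.If_cases of_bool_def Int_def)
  have card_ur: "card {m \<in> {1..k}. m < l \<and> y m \<notin> ur} = (\<Sum>m\<in>{1..k}. of_bool (m < l \<and> y m \<notin> ur))" for l
    by (simp add: sum.If_cases of_bool_def Int_def)
  have "pair_sum k (\<lambda>a b. of_bool (f a = Rows \<and> y b \<in> ll) + of_bool (y a \<notin> ur \<and> f b = Rows)) =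
      (\<Sum>a\<in>{1..k}. \<Sum>b\<in>{1..k}. of_bool (f a = Rows) * of_bool (a < b \<and> y b \<in> ll)) +
      (\<Sum>a\<in>{1..k}. \<Sum>b\<in>{1..k}. of_bool (f b = Rows) * of_bool (a < b \<and> y a \<notin> ur))"
    unfolding pair_sum_def sum.distrib[symmetric]
    by (intro sum.cong refl) (auto simp: of_bool_def)
  also have "(\<Sum>a\<in>{1..k}. \<Sum>b\<in>{1..k}. of_bool (f b = Rows) * of_bool (a < b \<and> y a \<notin> ur)) =
      (\<Sum>b\<in>{1..k}. \<Sum>a\<in>{1..k}. of_bool (f b = Rows) * (of_bool (a < b \<and> y a \<notin> ur) :: nat))"
    by (rule sum.swap)
  also have "(\<Sum>a\<in>{1..k}. \<Sum>b\<in>{1..k}. of_bool (f a = Rows) * of_bool (a < b \<and> y b \<in> ll)) + \<dots> =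
      (\<Sum>l\<in>{1..k}. if f l = Rows then exponent k y l else 0)"
    unfolding exponent_def card_ll card_ur sum_distrib_left[symmetric]
    by (subst sum.distrib[symmetric]) (intro sum.cong refl, simp)
  finally show ?thesis .
qed

lemma pair_sum_add: "pair_sum k (\<lambda>a b. g a b + h a b) = pair_sum k g + pair_sum k h"
  unfolding pair_sum_def sum.distrib[symmetric] by (intro sum.cong refl) simp

lemma pair_sum_cong:
  "(\<And>a b. a \<in> {1..k} \<Longrightarrow> b \<in> {1..k} \<Longrightarrow> g a b = h a b) \<Longrightarrow> pair_sum k g = pair_sum k h"
  unfolding pair_sum_def by (intro sum.cong refl) simp

lemma pair_sum_new:
  "pair_sum k (\<lambda>a b. energy_new (y a) (y b)) =
   pair_sum k (\<lambda>a b. energy_core (y a) (y b)) + (\<Sum>l\<in>{1..k}. if y l = Rows then exponent k y l else 0)"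
  by (simp only: energy_new_core add.assoc pair_sum_rows[symmetric])
    (simp only: pair_sum_add)

lemma pair_sum_old:
  assumes "\<And>a. a \<in> {1..k} \<Longrightarrow> f a \<in> turn (y a)"
  shows "pair_sum k (\<lambda>a b. energy_old (f a) (f b)) =
    pair_sum k (\<lambda>a b. energy_core (y a) (y b)) + (\<Sum>l\<in>{1..k}. if f l = Rows then exponent k y l else 0)"
proof -
  have "pair_sum k (\<lambda>a b. energy_old (f a) (f b)) = pair_sum k (\<lambda>a b. energy_core (y a) (y b) +
      (of_bool (f a = Rows \<and> y b \<in> ll) + of_bool (y a \<notin> ur \<and> f b = Rows)))"
    by (intro pair_sum_cong) (simp add: energy_old_core[OF assms assms] add.assoc)
  also have "\<dots> = pair_sum k (\<lambda>a b. energy_core (y a) (y b)) +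
      pair_sum k (\<lambda>a b. of_bool (f a = Rows \<and> y b \<in> ll) + of_bool (y a \<notin> ur \<and> f b = Rows))"
    by (rule pair_sum_add)
  finally show ?thesis unfolding pair_sum_rows .
qed

text \<open>
  The finite product \<open>(-1; t)\<^sub>m\<close>, a \<open>q\<close>-Pochhammer symbol with base \<open>t\<close>.
\<close>

definition phi :: "real \<Rightarrow> nat \<Rightarrow> real" where
  "phi t m = (\<Prod>j<m. 1 + t ^ j)"

lemma phi_simps [simp]: "phi t 0 = 1" "phi t (Suc m) = phi t m * (1 + t ^ m)"
  by (simp_all add: phi_def)

lemma phi_pos: "t \<ge> 0 \<Longrightarrow> phi t m > 0"
  by (induction m) (auto intro!: mult_pos_pos add_pos_nonneg)

text \<open>
  The factors \<open>1 + t\<^sup>e\<close> come on the left from the destroyed pairs and on the right from the created ones. Going through the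
  colors from \<open>1\<close> to \<open>k\<close>, the number \<open>F\<close> of colors \<open>m\<close> up to the current one with \<open>y m \<notin> ur\<close> plus the number of later
  colors with \<open>y m \<in> ll\<close> increases by one at a color of the first kind, decreases by one at a color of the second kind and stays
  the same otherwise; each factor is the corresponding quotient of two values of \<open>phi\<close>.
\<close>

lemma phi_telescope:
  "phi t (card {m \<in> {1..k}. y m \<in> ll}) * (\<Prod>l\<in>{1..k}. if y l = Vacant then 1 + t ^ exponent k y l else 1) =
   phi t (card {m \<in> {1..k}. y m \<notin> ur}) * (\<Prod>l\<in>{1..k}. if y l \<in> {Rows, Columns} then 1 + t ^ exponent k y l else 1)"
proof -
  define F where "F j = card {m \<in> {1..k}. m > j \<and> y m \<in> ll} + card {m \<in> {1..k}. m < Suc j \<and> y m \<notin> ur}" for j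
  have "phi t (F 0) * (\<Prod>l\<in>{1..j}. if y l = Vacant then 1 + t ^ exponent k y l else 1) =
    phi t (F j) * (\<Prod>l\<in>{1..j}. if y l \<in> {Rows, Columns} then 1 + t ^ exponent k y l else 1)" if "j \<le> k" for j
    using that
  proof (induction j)
    case (Suc j)
    let ?l = "Suc j" and ?e = "exponent k y (Suc j)"
    have "{m \<in> {1..k}. m > j \<and> y m \<in> ll} =
        (if y ?l \<in> ll then insert ?l {m \<in> {1..k}. m > ?l \<and> y m \<in> ll} else {m \<in> {1..k}. m > ?l \<and> y m \<in> ll})"
      using Suc.prems by (auto, metis Suc_lessI)
    then have Fj: "F j = ?e + of_bool (y ?l \<in> ll)"
      by (simp add: F_def exponent_def)
    have "{m \<in> {1..k}. m < Suc ?l \<and> y m \<notin> ur} =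
        (if y ?l \<notin> ur then insert ?l {m \<in> {1..k}. m < ?l \<and> y m \<notin> ur} else {m \<in> {1..k}. m < ?l \<and> y m \<notin> ur})"
      using Suc.prems by (auto simp: less_Suc_eq)
    then have Fl: "F ?l = ?e + of_bool (y ?l \<notin> ur)"
      by (simp add: F_def exponent_def)
    have step: "phi t (F j) * (if y ?l = Vacant then 1 + t ^ ?e else 1) =
        phi t (F ?l) * (if y ?l \<in> {Rows, Columns} then 1 + t ^ ?e else 1)"
      unfolding Fj Fl by (cases "y ?l") (simp_all add: covering_defs)
    have combine: "z * (A * v) = q * (B * w)" if "p * v = q * w" "z * A = p * B" for z A p B v q w :: real
      using that by algebra
    have split: "(\<Prod>l\<in>{1..Suc j}. g l) = (\<Prod>l\<in>{1..j}. g l) * g (Suc j)" for g :: "nat \<Rightarrow> real"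
      by simp
    show ?case
      unfolding split by (rule combine[OF step Suc.IH]) (use Suc.prems in simp)
  qed simp
  from this[of k] have "phi t (F 0) * (\<Prod>l\<in>{1..k}. if y l = Vacant then 1 + t ^ exponent k y l else 1) =
    phi t (F k) * (\<Prod>l\<in>{1..k}. if y l \<in> {Rows, Columns} then 1 + t ^ exponent k y l else 1)"
    by blast
  moreover have "F 0 = card {m \<in> {1..k}. y m \<in> ll}"
  proof -
    have "{m \<in> {1..k}. m > 0 \<and> y m \<in> ll} = {m \<in> {1..k}. y m \<in> ll}"
      "{m \<in> {1..k}. m < Suc 0 \<and> y m \<notin> ur} = {}" by auto
    then show ?thesis unfolding F_def by simp
  qed
  moreover have "F k = card {m \<in> {1..k}. y m \<notin> ur}"
  proof -
    have "{m \<in> {1..k}. m > k \<and> y m \<in> ll} = {}"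
      "{m \<in> {1..k}. m < Suc k \<and> y m \<notin> ur} = {m \<in> {1..k}. y m \<notin> ur}" by auto
    then show ?thesis unfolding F_def by simp
  qed
  ultimately show ?thesis by (simp only:)
qed

text \<open>
  The contribution of color \<open>l\<close> at one block to the probability of the step.
\<close>

definition creation_prob :: "nat \<Rightarrow> real \<Rightarrow> (nat \<Rightarrow> local_state) \<Rightarrow> nat \<Rightarrow> real" where
  "creation_prob k t y l =
     (if y l = Rows then t ^ exponent k y l / (1 + t ^ exponent k y l)
      else if y l = Columns then 1 / (1 + t ^ exponent k y l) else 1)"

text \<open>
  Summing over the states before the step that lead to \<open>y\<close> means choosing the orientations of the destroyed pairs. The
  sum factors over the colors, each destroyed pair giving \<open>1 + t\<^sup>e\<close>; the denominators of the creation
  probabilities have the same form and \<open>phi_telescope\<close> compares the two.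
\<close>

lemma local_balance:
  assumes "t \<ge> 0"
  shows "(\<Sum>f\<in>(\<Pi>\<^sub>E a\<in>{1..k}. turn (y a)). t ^ pair_sum k (\<lambda>a b. energy_old (f a) (f b))) *
      (\<Prod>l\<in>{1..k}. creation_prob k t y l) * phi t (card {m \<in> {1..k}. y m \<in> ll}) =
    t ^ pair_sum k (\<lambda>a b. energy_new (y a) (y b)) * phi t (card {m \<in> {1..k}. y m \<notin> ur})"
proof -
  let ?e = "exponent k y" and ?C = "pair_sum k (\<lambda>a b. energy_core (y a) (y b))"
  have pos: "1 + t ^ n \<noteq> 0" for n
    using assms zero_le_power[of t n] by linarith
  have power: "t ^ (\<Sum>l\<in>{1..k}. if f l = Rows then ?e l else 0) = (\<Prod>l\<in>{1..k}. if f l = Rows then t ^ ?e l else 1)" for f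
    by (simp add: power_sum if_distrib cong: if_cong)
  have "(\<Sum>f\<in>(\<Pi>\<^sub>E a\<in>{1..k}. turn (y a)). t ^ pair_sum k (\<lambda>a b. energy_old (f a) (f b))) =
      (\<Sum>f\<in>(\<Pi>\<^sub>E a\<in>{1..k}. turn (y a)). t ^ ?C * (\<Prod>l\<in>{1..k}. if f l = Rows then t ^ ?e l else 1))"
  proof (intro sum.cong refl)
    fix f assume "f \<in> (\<Pi>\<^sub>E a\<in>{1..k}. turn (y a))"
    then have "f a \<in> turn (y a)" if "a \<in> {1..k}" for a using that by blast
    from pair_sum_old[of k f y, OF this]
    show "t ^ pair_sum k (\<lambda>a b. energy_old (f a) (f b)) = t ^ ?C * (\<Prod>l\<in>{1..k}. if f l = Rows then t ^ ?e l else 1)"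
      by (simp only: power_add power)
  qed
  also have "\<dots> = t ^ ?C * (\<Prod>l\<in>{1..k}. \<Sum>x\<in>turn (y l). if x = Rows then t ^ ?e l else 1)"
    by (subst prod_sum_PiE) (auto simp: sum_distrib_left)
  also have "(\<Prod>l\<in>{1..k}. \<Sum>x\<in>turn (y l). if x = Rows then t ^ ?e l else 1) =
      (\<Prod>l\<in>{1..k}. if y l = Vacant then 1 + t ^ ?e l else 1)"
  proof (intro prod.cong refl)
    fix l show "(\<Sum>x\<in>turn (y l). if x = Rows then t ^ ?e l else 1) = (if y l = Vacant then 1 + t ^ ?e l else 1)"
      by (cases "y l") simp_all
  qed
  finally have old: "(\<Sum>f\<in>(\<Pi>\<^sub>E a\<in>{1..k}. turn (y a)). t ^ pair_sum k (\<lambda>a b. energy_old (f a) (f b))) =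
      t ^ ?C * (\<Prod>l\<in>{1..k}. if y l = Vacant then 1 + t ^ ?e l else 1)" .
  have "(\<Prod>l\<in>{1..k}. if y l \<in> {Rows, Columns} then 1 + t ^ ?e l else 1) * (\<Prod>l\<in>{1..k}. creation_prob k t y l) =
      (\<Prod>l\<in>{1..k}. if y l = Rows then t ^ ?e l else 1)"
    unfolding prod.distrib[symmetric] using pos by (intro prod.cong refl) (auto simp: creation_prob_def)
  then have new: "t ^ pair_sum k (\<lambda>a b. energy_new (y a) (y b)) = t ^ ?C *
      ((\<Prod>l\<in>{1..k}. if y l \<in> {Rows, Columns} then 1 + t ^ ?e l else 1) * (\<Prod>l\<in>{1..k}. creation_prob k t y l))"
    unfolding pair_sum_new power_add power by simp
  show ?thesis
    unfolding old new using phi_telescope[of t k y] by (simp only: mult_ac)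
qed

section \<open>The weight as a product over blocks\<close>

fun domino_at :: "dir \<Rightarrow> square \<Rightarrow> domino" where
  "domino_at North s = Vert s"
| "domino_at East s = Hor s"
| "domino_at South s = Vert (move South s)"
| "domino_at West s = Hor (move West s)"

lemma cells_domino_at: "cells (domino_at r s) = {s, move r s}"
  by (cases r) auto

lemma move_dir_inj: "move r s = move r' s \<longleftrightarrow> r = r'"
  by (cases r; cases r'; cases s) (auto simp: move.simps)

lemma direction_iff:
  assumes "D \<in> tilings R" "s \<in> aztec R"
  shows "direction D s = r \<longleftrightarrow> domino_at r s \<in> D"
proof -
  have at: "d = domino_at r s" if "cells d = {s, move r s}" for d r
  proof -
    have "s \<in> cells d" using that by simp
    then obtain r' where r': "d = domino_at r' s"
      unfolding mem_cells by (metis domino_at.simps)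
    then have "move r' s = move r s"
      using that cells_domino_at[of r' s] by (auto simp: doubleton_eq_iff)
    with r' show ?thesis by (simp add: move_dir_inj)
  qed
  have at_iff: "(\<exists>d\<in>D. cells d = {s, move r s}) \<longleftrightarrow> domino_at r s \<in> D" for r
    using at cells_domino_at by blast
  obtain d where d: "d \<in> D" "s \<in> cells d" and uniq: "\<And>e. e \<in> D \<Longrightarrow> s \<in> cells e \<Longrightarrow> e = d"
    using assms unfolding tilings_def by blast
  obtain r0 where r0: "d = domino_at r0 s"
    using d(2) unfolding mem_cells by (metis domino_at.simps)
  have "r = r0" if "domino_at r s \<in> D" for r
  proof -
    have "domino_at r s = domino_at r0 s"
      using uniq[OF that] cells_domino_at[of r s] r0 by simp
    then have "{s, move r s} = {s, move r0 s}" by (metis cells_domino_at)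
    then show ?thesis by (auto simp: doubleton_eq_iff move_dir_inj)
  qed
  then have "domino_at r s \<in> D \<longleftrightarrow> r = r0" for r using d(1) r0 by blast
  then show ?thesis
    unfolding direction_def at_iff by auto
qed

lemma state_mem:
  assumes "consistent n D" "white n v"
  shows "Hor v \<in> D \<longleftrightarrow> state D v \<in> {Bottom, Rows}" "Hor (move North v) \<in> D \<longleftrightarrow> state D v \<in> {Top, Rows}"
    "Vert v \<in> D \<longleftrightarrow> state D v \<in> {Left, Columns}" "Vert (move East v) \<in> D \<longleftrightarrow> state D v \<in> {Right, Columns}"
  using assms by (auto simp: consistent_def state_def)

lemma direction_white:
  assumes "D \<in> tilings R" "s \<in> aztec R" "white n s"
  shows "direction D s = East \<longleftrightarrow> state D s \<in> {Bottom, Rows}"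
    "direction D s = North \<longleftrightarrow> state D s \<in> {Left, Columns}"
    "direction D s = West \<longleftrightarrow> state D (lower_left s) \<in> {Top, Rows}"
    "direction D s = South \<longleftrightarrow> state D (lower_left s) \<in> {Right, Columns}"
  using state_mem[OF tilings_consistent[OF assms(1)] assms(3)]
    state_mem[OF tilings_consistent[OF assms(1)], of n "lower_left s"] assms(3)
  by (simp_all add: direction_iff[OF assms(1,2)])

lemma direction_gray:
  assumes "D \<in> tilings R" "s \<in> aztec R" "\<not> white n s"
  shows "direction D s = East \<longleftrightarrow> state D (move South s) \<in> {Top, Rows}"
    "direction D s = North \<longleftrightarrow> state D (move West s) \<in> {Right, Columns}"
    "direction D s = West \<longleftrightarrow> state D (move West s) \<in> {Bottom, Rows}"
    "direction D s = South \<longleftrightarrow> state D (move South s) \<in> {Left, Columns}"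
  using state_mem[OF tilings_consistent[OF assms(1)], of n "move South s"]
    state_mem[OF tilings_consistent[OF assms(1)], of n "move West s"] assms(3)
  by (simp_all add: direction_iff[OF assms(1,2)])

abbreviation interacting :: "(dir \<times> dir) set" where
  "interacting \<equiv> {(East, East), (East, West), (East, North), (North, West)}"

lemma interacting_iff:
  "(p, q) \<in> interacting \<longleftrightarrow> p = East \<and> (q = East \<or> q = North) \<or> (p = East \<or> p = North) \<and> q = West"
  "(p, q) \<in> interacting \<longleftrightarrow> p = East \<and> q \<noteq> South \<or> p = North \<and> q = West"
  by (cases p; cases q; simp)+

lemma card_filter_eq_sum: "finite A \<Longrightarrow> card {x \<in> A. P x} = (\<Sum>x\<in>A. of_bool (P x))"
  by (simp add: sum.If_cases of_bool_def Int_def)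

lemma mem_image_iff:
  assumes "\<And>x. g (f x) = x" "\<And>x. f (g x) = x"
  shows "s \<in> f ` A \<longleftrightarrow> g s \<in> A"
  using assms by (metis imageE imageI)

lemma card_interactions_new:
  assumes "A \<in> tilings (Suc T)" "B \<in> tilings (Suc T)"
  shows "card {s \<in> aztec (Suc T). white (Suc T) s \<and> (direction A s, direction B s) \<in> interacting} =
    (\<Sum>v\<in>blocks (Suc T). energy_new (state A v) (state B v))"
proof -
  let ?n = "Suc T"
  let ?P = "{s \<in> blocks ?n. state A s \<in> {Bottom, Rows} \<and> state B s \<in> ll}"
  let ?Q = "{v \<in> blocks ?n. state A v \<notin> ur \<and> state B v \<in> {Top, Rows}}"
  have ll_iff: "state D s \<in> ll \<longleftrightarrow> direction D s = East \<or> direction D s = North"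
    if "D \<in> tilings ?n" "s \<in> aztec ?n" "white ?n s" for D s
    using direction_white[OF that] by (auto simp: ll_def)
  \<comment> \<open>A white square points north or east exactly if it is not covered from the lower-left block.\<close>
  have ur_iff: "state D (lower_left s) \<notin> ur \<longleftrightarrow> direction D s = East \<or> direction D s = North"
    if "D \<in> tilings ?n" "s \<in> aztec ?n" "white ?n s" for D s
    using ll_iff[OF that] tilings_white[OF that(1,3)] that(2) by simp
  have out: "v \<in> blocks ?n" if "state D v \<noteq> Vacant" "D \<in> tilings ?n" "white ?n v" for D v
    using state_outside[of D ?n T v] that by auto
  have ends: "v \<in> aztec ?n" "upper_right v \<in> aztec ?n" "white ?n v" if "v \<in> blocks ?n" for v
    using that by (simp_all add: blocks_def block_def)
  have mem: "s \<in> {s \<in> aztec ?n. white ?n s \<and> (direction A s, direction B s) \<in> interacting} \<longleftrightarrow>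
      s \<in> ?P \<union> upper_right ` ?Q" for s
  proof (cases "s \<in> aztec ?n \<and> white ?n s")
    case True
    then have s: "s \<in> aztec ?n" "white ?n s" "white ?n (lower_left s)" by simp_all
    have img: "s \<in> upper_right ` ?Q \<longleftrightarrow> lower_left s \<in> ?Q"
      by (rule mem_image_iff) simp_all
    have P: "s \<in> ?P \<longleftrightarrow> direction A s = East \<and> (direction B s = East \<or> direction B s = North)"
      using direction_white(1)[OF assms(1) s(1,2)] ll_iff[OF assms(2) s(1,2)] out[OF _ assms(1) s(2)] by auto
    have Q: "lower_left s \<in> ?Q \<longleftrightarrow> (direction A s = East \<or> direction A s = North) \<and> direction B s = West"
      using direction_white(3)[OF assms(2) s(1,2)] ur_iff[OF assms(1) s(1,2)] out[OF _ assms(2) s(3)] by auto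
    show ?thesis unfolding Un_iff img P Q using s interacting_iff(1) by blast
  next
    case False
    moreover have "s \<in> aztec ?n \<and> white ?n s" if "s \<in> ?P"
      using that ends(1,3)[of s] by blast
    moreover have "s \<in> aztec ?n \<and> white ?n s" if "s \<in> upper_right ` ?Q"
    proof -
      obtain v where v: "s = upper_right v" "v \<in> ?Q" using \<open>s \<in> upper_right ` ?Q\<close> by (rule imageE)
      then show ?thesis using ends(2,3)[of v] by simp
    qed
    ultimately show ?thesis by blast
  qed
  have union: "{s \<in> aztec ?n. white ?n s \<and> (direction A s, direction B s) \<in> interacting} = ?P \<union> upper_right ` ?Q"
    by (rule set_eqI) (rule mem)
  have disj: "?P \<inter> upper_right ` ?Q = {}"
  proof -
    have False if "v \<in> ?Q" "upper_right v \<in> ?P" for v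
    proof -
      have s: "white ?n (upper_right v)" "upper_right v \<in> aztec ?n"
        using that(2) by (auto simp: blocks_def block_def)
      show False
        using direction_white(3)[OF assms(2) s(2,1)] ll_iff[OF assms(2) s(2,1)] that by auto
    qed
    then show ?thesis by blast
  qed
  have inj: "inj_on upper_right ?Q"
    by (rule inj_on_inverseI[of _ lower_left]) simp
  have "card (?P \<union> upper_right ` ?Q) = card ?P + card (upper_right ` ?Q)"
    by (rule card_Un_disjoint[OF _ _ disj]) simp_all
  then show ?thesis
    unfolding union card_image[OF inj] card_filter_eq_sum[OF finite_blocks] energy_new_def sum.distrib .
qed

lemma card_interactions_old:
  assumes "A \<in> tilings T" "B \<in> tilings T"
  shows "card {s \<in> aztec T. white T s \<and> (direction A s, direction B s) \<in> interacting} =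
    (\<Sum>v\<in>blocks (Suc T). energy_old (state A v) (state B v))"
proof -
  let ?n = "Suc T"
  let ?P = "{v \<in> blocks ?n. state A v \<in> {Top, Rows} \<and> state B v \<notin> {Left, Columns}}"
  let ?Q = "{v \<in> blocks ?n. state A v \<in> {Right, Columns} \<and> state B v \<in> {Bottom, Rows}}"
  have img: "s \<in> move North ` ?P \<longleftrightarrow> move South s \<in> ?P" "s \<in> move East ` ?Q \<longleftrightarrow> move West s \<in> ?Q" for s
    by (rule mem_image_iff; simp)+
  have P: "move South s \<in> ?P \<longleftrightarrow> s \<in> aztec T \<and> direction A s = East \<and> direction B s \<noteq> South"
    and Q: "move West s \<in> ?Q \<longleftrightarrow> s \<in> aztec T \<and> direction A s = North \<and> direction B s = West"
    if s: "\<not> white ?n s" for s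
  proof -
    have "s \<in> aztec T" if "state A (move South s) \<in> ul \<or> state A (move West s) \<in> lr"
      using tilings_gray[OF assms(1) s] that by (auto split: if_splits)
    then have az: "s \<in> aztec T" if "state A (move South s) \<in> {Top, Rows} \<or> state A (move West s) \<in> {Right, Columns}"
      using that by (auto simp: covering_defs)
    show "move South s \<in> ?P \<longleftrightarrow> s \<in> aztec T \<and> direction A s = East \<and> direction B s \<noteq> South"
    proof (cases "s \<in> aztec T")
      case True
      then show ?thesis
        using direction_gray[OF assms(1) True s] direction_gray[OF assms(2) True s] gray_mem_aztec(1)[OF s] by auto
    qed (use az in auto)
    show "move West s \<in> ?Q \<longleftrightarrow> s \<in> aztec T \<and> direction A s = North \<and> direction B s = West"
    proof (cases "s \<in> aztec T")
      case True
      then show ?thesis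
        using direction_gray[OF assms(1) True s] direction_gray[OF assms(2) True s] gray_mem_aztec(1)[OF s] by auto
    qed (use az in auto)
  qed
  have gray: "\<not> white ?n s" if img: "s \<in> move r ` ?P \<or> s \<in> move r ` ?Q" for r s
  proof -
    obtain v where "s = move r v" "v \<in> blocks ?n" using img by blast
    then show ?thesis using white_blocks[of v ?n] by simp
  qed
  have mem: "s \<in> {s \<in> aztec T. white T s \<and> (direction A s, direction B s) \<in> interacting} \<longleftrightarrow>
      s \<in> move North ` ?P \<union> move East ` ?Q" for s
  proof (cases "white ?n s")
    case False
    show ?thesis unfolding Un_iff img P[OF False] Q[OF False] using False interacting_iff(2) by auto
  next
    case True
    then have "s \<notin> move North ` ?P" "s \<notin> move East ` ?Q" using gray by blast+
    then show ?thesis using True by simp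
  qed
  have union: "{s \<in> aztec T. white T s \<and> (direction A s, direction B s) \<in> interacting} = move North ` ?P \<union> move East ` ?Q"
    by (rule set_eqI) (rule mem)
  have disj: "move North ` ?P \<inter> move East ` ?Q = {}"
  proof -
    have False if "s \<in> move North ` ?P" "s \<in> move East ` ?Q" for s
    proof -
      have "\<not> white ?n s" using that(1) gray by blast
      moreover have "move South s \<in> ?P" "move West s \<in> ?Q"
        using that unfolding img by blast+
      ultimately show False using P[of s] Q[of s] by simp
    qed
    then show ?thesis by blast
  qed
  have inj: "inj_on (move r) S" for r S
    by (simp add: inj_on_def)
  have "card (move North ` ?P \<union> move East ` ?Q) = card (move North ` ?P) + card (move East ` ?Q)"
    by (rule card_Un_disjoint[OF _ _ disj]) simp_all
  then show ?thesis
    unfolding union card_image[OF inj] card_filter_eq_sum[OF finite_blocks] energy_old_def sum.distrib .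
qed

lemma card_interactions:
  assumes "\<And>a b. a \<in> {1..k} \<Longrightarrow> b \<in> {1..k} \<Longrightarrow>
    card {s \<in> aztec R. white R s \<and> (direction (X a) s, direction (X b) s) \<in> interacting} = (\<Sum>v\<in>B. h v a b)"
  shows "card (interactions k R X) = (\<Sum>v\<in>B. pair_sum k (h v))"
proof -
  let ?S = "\<lambda>a b. {s \<in> aztec R. white R s \<and> (direction (X a) s, direction (X b) s) \<in> interacting}"
  have eq: "interactions k R X = (SIGMA a:{1..k}. SIGMA b:{1..k}. if a < b then ?S a b else {})"
    by (auto simp: interactions_def split: if_splits)
  have "card (interactions k R X) = (\<Sum>a\<in>{1..k}. \<Sum>b\<in>{1..k}. card (if a < b then ?S a b else {}))"
    unfolding eq by (subst card_SigmaI; (intro ballI finite_SigmaI)?; simp)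
  also have "\<dots> = (\<Sum>a\<in>{1..k}. \<Sum>b\<in>{1..k}. \<Sum>v\<in>B. if a < b then h v a b else 0)"
  proof (intro sum.cong refl)
    fix a b assume "a \<in> {1..k}" "b \<in> {1..k}"
    then show "card (if a < b then ?S a b else {}) = (\<Sum>v\<in>B. if a < b then h v a b else 0)"
      using assms[of a b] by (cases "a < b") (simp_all only: if_True if_False card.empty sum.neutral_const)
  qed
  also have "\<dots> = (\<Sum>a\<in>{1..k}. \<Sum>v\<in>B. \<Sum>b\<in>{1..k}. if a < b then h v a b else 0)"
    by (intro sum.cong refl sum.swap)
  also have "\<dots> = (\<Sum>v\<in>B. pair_sum k (h v))"
    unfolding pair_sum_def by (rule sum.swap)
  finally show ?thesis .
qed

lemma wt_new:
  assumes "Y \<in> ktilings k (Suc T)"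
  shows "wt k (Suc T) t Y =
    (\<Prod>v\<in>blocks (Suc T). t ^ pair_sum k (\<lambda>a b. energy_new (state (Y a) v) (state (Y b) v)))"
  unfolding wt_def power_sum[symmetric]
  by (subst card_interactions[OF card_interactions_new]) (use assms in \<open>auto simp: ktilings_def\<close>)

text \<open>
  The weight in rank \<open>T\<close> is distributed over the blocks of rank \<open>T + 1\<close>, so that it can be compared with the
  weight after the step.
\<close>

lemma wt_old:
  assumes "X \<in> ktilings k T"
  shows "wt k T t X =
    (\<Prod>v\<in>blocks (Suc T). t ^ pair_sum k (\<lambda>a b. energy_old (state (X a) v) (state (X b) v)))"
  unfolding wt_def power_sum[symmetric]
  by (subst card_interactions[OF card_interactions_old]) (use assms in \<open>auto simp: ktilings_def\<close>)

section \<open>The probability of a step\<close>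

text \<open>
  The new local states if \<open>h\<close> tells which creation blocks are filled with horizontal dominoes.
\<close>

definition refill :: "domino set \<Rightarrow> (square \<Rightarrow> bool) \<Rightarrow> square \<Rightarrow> local_state" where
  "refill D h v = (if state D v = Vacant then if h v then Rows else Columns else slid (state D v))"

text \<open>
  The tiling \<open>E\<close> can be reached from \<open>D\<close> in one step.
\<close>

definition turned :: "nat \<Rightarrow> domino set \<Rightarrow> domino set \<Rightarrow> bool" where
  "turned T D E \<longleftrightarrow> (\<forall>v\<in>blocks (Suc T). state E v \<in> turn (state D v))"

lemma refill_turn: "refill D h v \<in> turn (state D v)"
  by (cases "state D v") (auto simp: refill_def)

lemma refill_eq_iff:
  assumes "x \<in> turn (state D v)"
  shows "refill D h v = x \<longleftrightarrow> (state D v = Vacant \<longrightarrow> h v = (x = Rows))"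
  using assms by (cases "state D v") (auto simp: refill_def)

lemma fill_slide:
  assumes "D \<in> tilings T"
  shows "slide_destroy T D \<union> (\<Union>s\<in>creation_blocks (Suc T) (slide_destroy T D).
      if h s then {Hor s, Hor (move North s)} else {Vert s, Vert (move East s)}) =
    assemble (Suc T) (refill D h)"
proof -
  have "parts (slid (state D v)) v \<union> (if state D v = Vacant
      then if h v then {Hor v, Hor (move North v)} else {Vert v, Vert (move East v)} else {}) =
    parts (refill D h v) v" for v
    by (simp add: refill_def)
  then have "assemble (Suc T) (refill D h) = (\<Union>v\<in>blocks (Suc T). parts (slid (state D v)) v) \<union>
      (\<Union>v\<in>blocks (Suc T). if state D v = Vacant
        then if h v then {Hor v, Hor (move North v)} else {Vert v, Vert (move East v)} else {})"
    unfolding assemble_def UN_Un_distrib[symmetric] by simp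
  also have "(\<Union>v\<in>blocks (Suc T). if state D v = Vacant
        then if h v then {Hor v, Hor (move North v)} else {Vert v, Vert (move East v)} else {}) =
      (\<Union>s\<in>creation_blocks (Suc T) (slide_destroy T D).
        if h s then {Hor s, Hor (move North s)} else {Vert s, Vert (move East s)})"
    unfolding creation_blocks_slide[OF assms] by (rule set_eqI) (simp split: if_splits, blast)
  finally show ?thesis
    unfolding slide_destroy_eq[OF assms] by (simp add: assemble_def)
qed

lemma state_refill:
  assumes "v \<in> blocks (Suc T)"
  shows "state (assemble (Suc T) (refill D h)) v = refill D h v"
  using assms by (simp add: state_assemble[OF white_blocks[OF assms]])

lemma refill_tilings:
  assumes "D \<in> tilings T"
  shows "assemble (Suc T) (refill D h) \<in> tilings (Suc T)" "turned T D (assemble (Suc T) (refill D h))"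
proof -
  show "assemble (Suc T) (refill D h) \<in> tilings (Suc T)"
    using assms by (rule assemble_turn_tilings) (auto intro: refill_turn)
  show "turned T D (assemble (Suc T) (refill D h))"
    by (auto simp: turned_def state_refill refill_turn)
qed

lemma refill_assemble_eq_iff:
  assumes "E \<in> tilings (Suc T)" "turned T D E"
  shows "assemble (Suc T) (refill D h) = E \<longleftrightarrow>
    (\<forall>v\<in>{v \<in> blocks (Suc T). state D v = Vacant}. h v = (state E v = Rows))"
proof -
  have "assemble (Suc T) (refill D h) = E \<longleftrightarrow> (\<forall>v\<in>blocks (Suc T). refill D h v = state E v)"
  proof
    assume "assemble (Suc T) (refill D h) = E"
    then show "\<forall>v\<in>blocks (Suc T). refill D h v = state E v"
      using state_refill[of _ T D h] by simp
  next
    assume "\<forall>v\<in>blocks (Suc T). refill D h v = state E v"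
    then have "assemble (Suc T) (refill D h) = assemble (Suc T) (state E)"
      by (intro assemble_cong) blast
    then show "assemble (Suc T) (refill D h) = E"
      using assemble_state[OF assms(1) subset_refl] by simp
  qed
  also have "\<dots> \<longleftrightarrow> (\<forall>v\<in>blocks (Suc T). state D v = Vacant \<longrightarrow> h v = (state E v = Rows))"
    using assms(2) by (simp add: turned_def refill_eq_iff)
  finally show ?thesis by blast
qed

abbreviation slides :: "nat \<Rightarrow> nat \<Rightarrow> (nat \<Rightarrow> domino set) \<Rightarrow> nat \<Rightarrow> domino set" where
  "slides k T X \<equiv> (\<lambda>a\<in>{1..k}. slide_destroy T (X a))"

lemma fill_color_eq:
  assumes "Z l = slide_destroy T D" "D \<in> tilings T"
  shows "fill_color k t (Suc T) l Z =
    map_pmf (\<lambda>h. Z(l := assemble (Suc T) (refill D h)))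
      (Pi_pmf {v \<in> blocks (Suc T). state D v = Vacant} False
        (\<lambda>s. let n = count1 k (Suc T) Z l s + count2 k Z l s in bernoulli_pmf (t ^ n / (1 + t ^ n))))"
  unfolding fill_color_def assms(1) fill_slide[OF assms(2)]
  by (simp only: creation_blocks_slide[OF assms(2)])

lemma ktilingsD: "X \<in> ktilings k T \<Longrightarrow> a \<in> {1..k} \<Longrightarrow> X a \<in> tilings T"
  by (auto simp: ktilings_def)

lemma fill_colors_support:
  assumes "X \<in> ktilings k T" "l \<le> k" "Z \<in> set_pmf (fill_colors k t (Suc T) l (slides k T X))"
  shows "(\<forall>m. m \<notin> {1..l} \<longrightarrow> Z m = slides k T X m) \<and>
    (\<forall>m\<in>{1..l}. Z m \<in> tilings (Suc T) \<and> turned T (X m) (Z m))"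
  using assms(2,3)
proof (induction l arbitrary: Z)
  case (Suc l)
  let ?D = "X (Suc l)"
  from Suc.prems(2)[unfolded fill_colors.simps(2) set_bind_pmf] obtain W where W: "W \<in> set_pmf (fill_colors k t (Suc T) l (slides k T X))"
    and Z: "Z \<in> set_pmf (fill_color k t (Suc T) (Suc l) W)" by blast
  note IH = Suc.IH[OF _ W]
  have D: "?D \<in> tilings T" using assms(1) Suc.prems(1) by (intro ktilingsD) auto
  have "W (Suc l) = slide_destroy T ?D" using IH Suc.prems(1) by simp
  from Z[unfolded fill_color_eq[of W "Suc l", OF this D]] obtain h where
    h: "Z = W(Suc l := assemble (Suc T) (refill ?D h))" by auto
  have "Z m = slides k T X m" if "m \<notin> {1..Suc l}" for m
    using that IH Suc.prems(1) h by auto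
  moreover have "Z m \<in> tilings (Suc T) \<and> turned T (X m) (Z m)" if "m \<in> {1..Suc l}" for m
    using that IH Suc.prems(1) h refill_tilings[OF D] by (cases "m = Suc l") auto
  ultimately show ?case by blast
qed simp

lemma pmf_bind_single:
  assumes "\<And>z. z \<in> set_pmf M \<Longrightarrow> z \<noteq> z0 \<Longrightarrow> y \<notin> set_pmf (f z)"
  shows "pmf (bind_pmf M f) y = pmf M z0 * pmf (f z0) y"
proof -
  have "pmf (bind_pmf M f) y = (\<Sum>a\<in>{z0}. pmf M a *\<^sub>R pmf (f a) y)"
    unfolding pmf_bind by (rule integral_measure_pmf) (use assms in \<open>auto simp: set_pmf_iff\<close>)
  then show ?thesis by simp
qed

lemma pmf_map_single:
  assumes "\<And>z. z \<in> set_pmf M \<Longrightarrow> f z = y \<longleftrightarrow> z = z0"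
  shows "pmf (map_pmf f M) y = pmf M z0"
proof -
  have "pmf (map_pmf f M) y = pmf M z0 * pmf (return_pmf (f z0)) y"
    unfolding map_pmf_def by (rule pmf_bind_single) (use assms in auto)
  also have "\<dots> = pmf M z0"
    using assms[of z0] by (cases "z0 \<in> set_pmf M") (auto simp: set_pmf_iff)
  finally show ?thesis .
qed

text \<open>
  The counts of the algorithm are taken from a configuration that is complete for the colors below \<open>l\<close> and
  partial for those above, but they can be read off from the final tilings \<open>Y\<close>: a block of a later color counts if it
  is a creation block or its lower-left square is covered by a slid domino, and in both cases the completed color covers this square
  from within the block. Hence the counts do not depend on how the creation blocks are filled.
\<close>

lemma count_eq_exponent:
  assumes X: "X \<in> ktilings k T" and Y: "Y \<in> ktilings k (Suc T)"
    and turned: "\<And>a. a \<in> {1..k} \<Longrightarrow> turned T (X a) (Y a)"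
    and s: "s \<in> blocks (Suc T)" and l: "l \<in> {1..k}"
    and Z: "\<And>m. m \<in> {1..k} \<Longrightarrow> m < l \<Longrightarrow> Z m = Y m"
      "\<And>m. m \<in> {1..k} \<Longrightarrow> l < m \<Longrightarrow> Z m = slide_destroy T (X m)"
  shows "count1 k (Suc T) Z l s + count2 k Z l s = exponent k (\<lambda>a. state (Y a) s) l"
proof -
  have w: "white (Suc T) s" "white (Suc T) (upper_right s)" using white_blocks[OF s] by simp_all
  have 1: "s \<in> creation_blocks (Suc T) (Z m) \<or> Vert s \<in> Z m \<or> Hor s \<in> Z m \<longleftrightarrow> state (Y m) s \<in> ll"
    if m: "m \<in> {1..k}" "l < m" for m
  proof -
    let ?P = "assemble (Suc T) (slid \<circ> state (X m))"
    have D: "X m \<in> tilings T" using X m(1) by (rule ktilingsD)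
    have "Hor s \<in> ?P \<or> Vert s \<in> ?P \<longleftrightarrow> slid (state (X m) s) \<in> ll"
      using state_covers(1)[OF consistent_assemble w(1), of "slid \<circ> state (X m)"]
        state_assemble[OF w(1), of "slid \<circ> state (X m)"] s by simp
    moreover have "state (Y m) s \<in> ll \<longleftrightarrow> state (X m) s \<notin> ll"
      using turned[OF m(1)] s turn_covers(1) by (auto simp: turned_def)
    moreover have "s \<in> creation_blocks (Suc T) (Z m) \<longleftrightarrow> state (X m) s = Vacant"
      unfolding Z(2)[OF m] creation_blocks_slide[OF D] using s by simp
    moreover have "Z m = ?P"
      unfolding Z(2)[OF m] by (rule slide_destroy_eq[OF D])
    ultimately show ?thesis
      using slid_covers(1)[of "state (X m) s"] by (cases "state (X m) s = Vacant") auto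
  qed
  have 2: "Hor (upper_right s) \<in> Z m \<or> Vert (upper_right s) \<in> Z m \<longleftrightarrow> state (Y m) s \<notin> ur"
    if m: "m \<in> {1..k}" "m < l" for m
  proof -
    have E: "Y m \<in> tilings (Suc T)" using Y m(1) by (rule ktilingsD)
    have "upper_right s \<in> aztec (Suc T)" using s by (simp add: blocks_def block_def)
    then have "state (Y m) (upper_right s) \<in> ll \<longleftrightarrow> state (Y m) s \<notin> ur"
      using tilings_white[OF E w(2)] by simp
    then show ?thesis
      unfolding Z(1)[OF m] using state_covers(1)[OF tilings_consistent[OF E] w(2)] by simp
  qed
  show ?thesis
    unfolding count1_def count2_def exponent_def
    using 1 2 by (intro arg_cong2[of _ _ _ _ "(+)"] arg_cong[of _ _ card] Collect_cong) auto
qed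

text \<open>
  Given the starting point and the target \<open>Y\<close>, there is only one possible configuration after each color, so the
  probabilities of the stages multiply.
\<close>

lemma pmf_fill_colors:
  assumes X: "X \<in> ktilings k T" and Y: "Y \<in> ktilings k (Suc T)" and t: "t \<ge> 0"
    and turned: "\<And>a. a \<in> {1..k} \<Longrightarrow> turned T (X a) (Y a)" and "l \<le> k"
  shows "pmf (fill_colors k t (Suc T) l (slides k T X)) (\<lambda>m. if m \<in> {1..l} then Y m else slides k T X m) =
    (\<Prod>m\<in>{1..l}. \<Prod>v\<in>blocks (Suc T). creation_prob k t (\<lambda>a. state (Y a) v) m)"
  using \<open>l \<le> k\<close>
proof (induction l)
  case 0
  then show ?case by simp
next
  case (Suc l)
  let ?Z = "\<lambda>l m. if m \<in> {1..l} then Y m else slides k T X m"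
  let ?D = "X (Suc l)" and ?E = "Y (Suc l)"
  let ?C = "{v \<in> blocks (Suc T). state ?D v = Vacant}"
  let ?e = "\<lambda>v. exponent k (\<lambda>a. state (Y a) v) (Suc l)"
  have l: "Suc l \<in> {1..k}" using Suc.prems by simp
  have D: "?D \<in> tilings T" and E: "?E \<in> tilings (Suc T)" and DE: "turned T ?D ?E"
    using X Y turned l by (auto intro: ktilingsD)
  have ZSuc: "?Z (Suc l) = (?Z l)(Suc l := ?E)"
    by (rule ext) (auto simp: le_Suc_eq)
  have before: "?Z l (Suc l) = slide_destroy T ?D" using l by simp
  have "?Z (Suc l) \<notin> set_pmf (fill_color k t (Suc T) (Suc l) W)"
    if W: "W \<in> set_pmf (fill_colors k t (Suc T) l (slides k T X))" "W \<noteq> ?Z l" for W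
  proof
    assume *: "?Z (Suc l) \<in> set_pmf (fill_color k t (Suc T) (Suc l) W)"
    have off: "W m = slides k T X m" if "m \<notin> {1..l}" for m
      using fill_colors_support[OF X _ W(1)] Suc.prems that by simp
    then have "W (Suc l) = slide_destroy T ?D" using l by simp
    from *[unfolded fill_color_eq[of W "Suc l", OF this D]]
    obtain h where h: "?Z (Suc l) = W(Suc l := assemble (Suc T) (refill ?D h))" by auto
    have "W m = ?Z l m" for m
    proof (cases "m = Suc l")
      case True
      then show ?thesis using off[of m] by simp
    next
      case False
      have "?Z (Suc l) m = W m" by (rule trans[OF fun_cong[OF h] fun_upd_other[OF False]])
      moreover have "m \<in> {1..Suc l} \<longleftrightarrow> m \<in> {1..l}" using False by auto
      ultimately show ?thesis by simp
    qed
    with W(2) show False by blast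
  qed
  then have "pmf (fill_colors k t (Suc T) (Suc l) (slides k T X)) (?Z (Suc l)) =
      pmf (fill_colors k t (Suc T) l (slides k T X)) (?Z l) *
      pmf (fill_color k t (Suc T) (Suc l) (?Z l)) (?Z (Suc l))"
    unfolding fill_colors.simps(2) by (rule pmf_bind_single)
  also have "pmf (fill_color k t (Suc T) (Suc l) (?Z l)) (?Z (Suc l)) =
      (\<Prod>v\<in>blocks (Suc T). creation_prob k t (\<lambda>a. state (Y a) v) (Suc l))"
  proof -
    let ?p = "\<lambda>s. let n = count1 k (Suc T) (?Z l) (Suc l) s + count2 k (?Z l) (Suc l) s
      in bernoulli_pmf (t ^ n / (1 + t ^ n))"
    have upd_eq: "f(Suc l := a) = f(Suc l := b) \<longleftrightarrow> a = b" for f :: "nat \<Rightarrow> domino set" and a b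
      by (auto dest: fun_upd_eqD)
    \<comment> \<open>The only choice of orientations that leads to \<open>?E\<close>; outside of the creation blocks it has the default value.\<close>
    let ?h = "\<lambda>v. v \<in> ?C \<and> state ?E v = Rows"
    have "pmf (fill_color k t (Suc T) (Suc l) (?Z l)) (?Z (Suc l)) = pmf (Pi_pmf ?C False ?p) ?h"
      unfolding fill_color_eq[of "?Z l" "Suc l", OF before D]
    proof (rule pmf_map_single)
      fix h assume "h \<in> set_pmf (Pi_pmf ?C False ?p)"
      then have "h v = False" if "v \<notin> ?C" for v
        using set_Pi_pmf_subset[of ?C False ?p] that by auto
      then have h: "h = ?h \<longleftrightarrow> (\<forall>v\<in>?C. h v = (state ?E v = Rows))"
        by (auto simp: fun_eq_iff)
      have "(?Z l)(Suc l := assemble (Suc T) (refill ?D h)) = ?Z (Suc l) \<longleftrightarrow>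
          assemble (Suc T) (refill ?D h) = ?E"
        unfolding ZSuc upd_eq ..
      then show "(?Z l)(Suc l := assemble (Suc T) (refill ?D h)) = ?Z (Suc l) \<longleftrightarrow> h = ?h"
        unfolding h refill_assemble_eq_iff[OF E DE] .
    qed
    also have "\<dots> = (\<Prod>v\<in>?C. pmf (?p v) (?h v))"
      by (subst pmf_Pi) auto
    also have "\<dots> = (\<Prod>v\<in>?C. creation_prob k t (\<lambda>a. state (Y a) v) (Suc l))"
    proof (intro prod.cong refl)
      fix v assume v: "v \<in> ?C"
      then have e: "count1 k (Suc T) (?Z l) (Suc l) v + count2 k (?Z l) (Suc l) v = ?e v"
        by (intro count_eq_exponent[OF X Y turned _ l]) auto
      have st: "state ?E v \<in> {Rows, Columns}"
        using DE v unfolding turned_def by fastforce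
      have pos: "1 + t ^ ?e v > 0" using t by (simp add: add_pos_nonneg)
      have "0 \<le> t ^ ?e v / (1 + t ^ ?e v)" "t ^ ?e v / (1 + t ^ ?e v) \<le> 1"
        using t pos by (simp_all add: divide_le_eq)
      then show "pmf (?p v) (?h v) = creation_prob k t (\<lambda>a. state (Y a) v) (Suc l)"
        unfolding Let_def e using st v pos by (auto simp: creation_prob_def field_simps)
    qed
    also have "\<dots> = (\<Prod>v\<in>blocks (Suc T). creation_prob k t (\<lambda>a. state (Y a) v) (Suc l))"
    proof (rule prod.mono_neutral_left)
      show "\<forall>v\<in>blocks (Suc T) - ?C. creation_prob k t (\<lambda>a. state (Y a) v) (Suc l) = 1"
      proof
        fix v assume v: "v \<in> blocks (Suc T) - ?C"
        then have "state ?E v \<in> turn (state ?D v)" using DE by (simp add: turned_def)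
        with v have "state ?E v \<noteq> Rows" "state ?E v \<noteq> Columns"
          by (cases "state ?D v"; auto)+
        then show "creation_prob k t (\<lambda>a. state (Y a) v) (Suc l) = 1"
          by (simp add: creation_prob_def)
      qed
    qed auto
    finally show ?thesis .
  qed
  finally show ?case using Suc by (simp add: mult.commute)
qed

lemma shuffle_step_support:
  assumes X: "X \<in> ktilings k T" and Y: "Y \<in> set_pmf (shuffle_step k t T X)"
  shows "Y \<in> ktilings k (Suc T)" "\<And>a. a \<in> {1..k} \<Longrightarrow> turned T (X a) (Y a)"
  using fill_colors_support[OF X order_refl Y[unfolded shuffle_step_def]]
  by (auto simp: ktilings_def PiE_def extensional_def)

lemma pmf_shuffle_step:
  assumes X: "X \<in> ktilings k T" and Y: "Y \<in> ktilings k (Suc T)" and t: "t \<ge> 0"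
  shows "pmf (shuffle_step k t T X) Y = (if \<forall>a\<in>{1..k}. turned T (X a) (Y a)
    then \<Prod>v\<in>blocks (Suc T). \<Prod>l\<in>{1..k}. creation_prob k t (\<lambda>a. state (Y a) v) l else 0)"
proof (cases "\<forall>a\<in>{1..k}. turned T (X a) (Y a)")
  case True
  have "(\<lambda>m. if m \<in> {1..k} then Y m else slides k T X m) = Y"
    using Y by (auto simp: ktilings_def PiE_def extensional_def fun_eq_iff)
  then have "pmf (shuffle_step k t T X) Y =
      (\<Prod>m\<in>{1..k}. \<Prod>v\<in>blocks (Suc T). creation_prob k t (\<lambda>a. state (Y a) v) m)"
    using pmf_fill_colors[OF X Y t _ order_refl] True by (simp add: shuffle_step_def)
  also have "\<dots> = (\<Prod>v\<in>blocks (Suc T). \<Prod>l\<in>{1..k}. creation_prob k t (\<lambda>a. state (Y a) v) l)"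
    by (rule prod.swap)
  finally show ?thesis using True by simp
next
  case False
  then have "Y \<notin> set_pmf (shuffle_step k t T X)"
    using shuffle_step_support(2)[OF X] by blast
  then have "pmf (shuffle_step k t T X) Y = 0" by (simp add: set_pmf_iff)
  with False show ?thesis by (simp only: False if_False)
qed

section \<open>Stationarity of the weights under the step\<close>

lemma finite_tilings [simp]: "finite (tilings R)"
proof (rule finite_subset)
  show "tilings R \<subseteq> Pow (\<Union>v\<in>blocks (Suc R). parts Rows v \<union> parts Columns v)"
  proof (intro subsetI PowI)
    fix D d assume D: "D \<in> tilings R" and d: "d \<in> D"
    have "d \<in> assemble (Suc R) (state D)"
      using assemble_state[OF D aztec_mono] d by simp
    then obtain v where "v \<in> blocks (Suc R)" "d \<in> parts (state D v) v"
      by (auto simp: assemble_def)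
    then show "d \<in> (\<Union>v\<in>blocks (Suc R). parts Rows v \<union> parts Columns v)"
      by (cases "state D v") auto
  qed
qed auto

lemma finite_ktilings [simp]: "finite (ktilings k R)"
  unfolding ktilings_def by (intro finite_PiE) auto

text \<open>
  The tilings of rank \<open>T\<close> from which \<open>Y\<close> can be reached are given by independent choices in all blocks, so
  the sum over them of a product over the blocks factors.
\<close>

lemma sum_over_sources:
  fixes h :: "square \<Rightarrow> (nat \<Rightarrow> local_state) \<Rightarrow> real"
  assumes Y: "Y \<in> ktilings k (Suc T)"
    and h: "\<And>v f g. (\<And>a. a \<in> {1..k} \<Longrightarrow> f a = g a) \<Longrightarrow> h v f = h v g"
  shows "(\<Sum>X\<in>{X \<in> ktilings k T. \<forall>a\<in>{1..k}. turned T (X a) (Y a)}. \<Prod>v\<in>blocks (Suc T). h v (\<lambda>a. state (X a) v)) =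
    (\<Prod>v\<in>blocks (Suc T). \<Sum>f\<in>(\<Pi>\<^sub>E a\<in>{1..k}. turn (state (Y a) v)). h v f)"
proof -
  let ?B = "blocks (Suc T)"
  let ?G = "\<Pi>\<^sub>E v\<in>?B. \<Pi>\<^sub>E a\<in>{1..k}. turn (state (Y a) v)"
  let ?to = "\<lambda>X. \<lambda>v\<in>?B. \<lambda>a\<in>{1..k}. state (X a) v"
  let ?from = "\<lambda>g. \<lambda>a\<in>{1..k}. assemble (Suc T) (\<lambda>v. g v a)"
  have "(\<Sum>X\<in>{X \<in> ktilings k T. \<forall>a\<in>{1..k}. turned T (X a) (Y a)}. \<Prod>v\<in>?B. h v (\<lambda>a. state (X a) v)) =
      (\<Sum>g\<in>?G. \<Prod>v\<in>?B. h v (g v))"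
  proof (rule sum.reindex_bij_witness[of _ ?from ?to])
    fix X assume X: "X \<in> {X \<in> ktilings k T. \<forall>a\<in>{1..k}. turned T (X a) (Y a)}"
    then have til: "X a \<in> tilings T" "turned T (X a) (Y a)" if "a \<in> {1..k}" for a
      using that by (auto intro: ktilingsD)
    show "?from (?to X) = X"
    proof (rule ext)
      fix a show "?from (?to X) a = X a"
      proof (cases "a \<in> {1..k}")
        case True
        have "assemble (Suc T) (\<lambda>v. ?to X v a) = assemble (Suc T) (state (X a))"
          using True by (intro assemble_cong) simp
        then show ?thesis using True assemble_state[OF til(1)[OF True] aztec_mono] by simp
      next
        case False
        have "X \<in> ktilings k T" using X by blast
        then have undef: "X a = undefined" unfolding ktilings_def by (rule PiE_arb) (rule False)
        show ?thesis by (simp only: restrict_apply if_not_P[OF False] undef)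
      qed
    qed
    show "?to X \<in> ?G"
      using til(2) turn_sym unfolding turned_def by (fastforce intro!: restrict_PiE_iff[THEN iffD2])
    show "(\<Prod>v\<in>?B. h v (?to X v)) = (\<Prod>v\<in>?B. h v (\<lambda>a. state (X a) v))"
      by (intro prod.cong refl h) simp
  next
    fix g assume g: "g \<in> ?G"
    have ga: "g v a \<in> turn (state (Y a) v)" if "v \<in> ?B" "a \<in> {1..k}" for v a
      using PiE_mem[OF PiE_mem[OF g that(1)] that(2)] .
    have st: "state (?from g a) v = g v a" if "v \<in> ?B" "a \<in> {1..k}" for v a
      using that by (simp add: state_assemble[OF white_blocks[OF that(1)]])
    show "?to (?from g) = g"
    proof (rule ext)
      fix v show "?to (?from g) v = g v"
      proof (cases "v \<in> ?B")
        case True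
        have "(\<lambda>a\<in>{1..k}. state (?from g a) v) = g v"
        proof (rule ext)
          fix a show "(\<lambda>a\<in>{1..k}. state (?from g a) v) a = g v a"
            using st[OF True, of a] PiE_arb[OF PiE_mem[OF g True], of a] by (cases "a \<in> {1..k}") simp_all
        qed
        with True show ?thesis by simp
      next
        case False
        with PiE_arb[OF g False] show ?thesis by simp
      qed
    qed
    have "assemble (Suc T) (\<lambda>v. g v a) \<in> tilings T" if "a \<in> {1..k}" for a
      using assemble_turn_tilings[OF ktilingsD[OF Y that], of T T "\<lambda>v. g v a"] ga that by simp
    then have "?from g \<in> ktilings k T"
      unfolding ktilings_def restrict_PiE_iff by blast
    moreover have "turned T (?from g a) (Y a)" if "a \<in> {1..k}" for a
      unfolding turned_def using st[OF _ that] ga[OF _ that] turn_sym by metis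
    ultimately show "?from g \<in> {X \<in> ktilings k T. \<forall>a\<in>{1..k}. turned T (X a) (Y a)}"
      by blast
  qed
  also have "\<dots> = (\<Prod>v\<in>?B. \<Sum>f\<in>(\<Pi>\<^sub>E a\<in>{1..k}. turn (state (Y a) v)). h v f)"
    by (subst prod_sum_PiE) (auto intro: finite_PiE)
  finally show ?thesis .
qed

text \<open>
  The lower-left square of a block is in general the upper-right square of another block, and whether it is covered
  from the one is decided by whether it is covered from the other. So the factors on both sides cancel in the
  interior of the diamond. What remains are the white squares at its boundary: the upper-right ends of the diagonals contribute
  \<open>phi t 0 = 1\<close>, and the lower-left ends, which must point north or east in all colors, contribute \<open>phi t k\<close>.
\<close>

lemma phi_boundary:
  assumes Y: "Y \<in> ktilings k (Suc T)"
  shows "(\<Prod>v\<in>blocks (Suc T). phi t (card {a \<in> {1..k}. state (Y a) v \<in> ll})) =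
    phi t k ^ card ({s \<in> aztec (Suc T). white (Suc T) s} - upper_right ` blocks (Suc T)) *
    (\<Prod>v\<in>blocks (Suc T). phi t (card {a \<in> {1..k}. state (Y a) v \<notin> ur}))"
proof -
  let ?n = "Suc T"
  let ?W = "{s \<in> aztec ?n. white ?n s}" and ?B = "blocks ?n"
  let ?U = "upper_right ` ?B"
  define N where "N s = card {a \<in> {1..k}. state (Y a) s \<in> ll}" for s
  have BW: "?B \<subseteq> ?W" by (auto simp: blocks_def block_def)
  have UW: "?U \<subseteq> ?W" by (auto simp: blocks_def block_def)
  have outside: "state (Y a) s = Vacant" if "a \<in> {1..k}" "white ?n s" "s \<notin> ?B" for a s
    using state_outside[OF ktilingsD[OF Y that(1)] subset_refl that(2,3)] .
  have flow: "state (Y a) s \<in> ll \<longleftrightarrow> state (Y a) (lower_left s) \<notin> ur" if "a \<in> {1..k}" "s \<in> ?W" for a s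
    using tilings_white[OF ktilingsD[OF Y that(1)], of ?n s] that(2) by simp
  \<comment> \<open>The upper-right end of a diagonal of white squares.\<close>
  have top: "N s = 0" if "s \<in> ?W - ?B" for s
  proof -
    have "{a \<in> {1..k}. state (Y a) s \<in> ll} = {}" using that outside[of _ s] by auto
    then show ?thesis by (simp only: N_def card.empty)
  qed
  \<comment> \<open>The lower-left end of a diagonal of white squares.\<close>
  have bottom: "N s = k" if s: "s \<in> ?W - ?U" for s
  proof -
    have "lower_left s \<notin> ?B" using s mem_image_iff[of lower_left upper_right s ?B] by simp
    then have "state (Y a) s \<in> ll" if "a \<in> {1..k}" for a
      using flow[OF that, of s] outside[OF that, of "lower_left s"] s by simp
    then have "{a \<in> {1..k}. state (Y a) s \<in> ll} = {1..k}" by blast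
    then show ?thesis by (simp add: N_def)
  qed
  have inner: "N (upper_right v) = card {a \<in> {1..k}. state (Y a) v \<notin> ur}" if "v \<in> ?B" for v
  proof -
    have "upper_right v \<in> ?W" using UW that by blast
    then show ?thesis
      unfolding N_def using flow[of _ "upper_right v"] by (intro arg_cong[of _ _ card] Collect_cong) auto
  qed
  have "(\<Prod>v\<in>?B. phi t (N v)) = (\<Prod>s\<in>?W. phi t (N s))"
    by (rule prod.mono_neutral_left) (use BW top in \<open>simp_all\<close>)
  also have "\<dots> = (\<Prod>s\<in>?W - ?U. phi t (N s)) * (\<Prod>s\<in>?U. phi t (N s))"
    by (rule prod.subset_diff) (use UW in simp_all)
  also have "(\<Prod>s\<in>?W - ?U. phi t (N s)) = (\<Prod>s\<in>?W - ?U. phi t k)"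
    by (intro prod.cong refl) (simp only: bottom)
  also have "\<dots> = phi t k ^ card (?W - ?U)" by (rule prod_constant)
  also have "(\<Prod>s\<in>?U. phi t (N s)) = (\<Prod>v\<in>?B. phi t (N (upper_right v)))"
    by (rule prod.reindex[unfolded comp_def]) (rule inj_on_inverseI[of _ lower_left], simp)
  also have "\<dots> = (\<Prod>v\<in>?B. phi t (card {a \<in> {1..k}. state (Y a) v \<notin> ur}))"
    by (intro prod.cong refl) (simp only: inner)
  finally show ?thesis unfolding N_def .
qed

text \<open>
  The main identity: the step maps the weights of rank \<open>T\<close> to a multiple of the weights of rank \<open>T + 1\<close>. It is the
  product of the local identities over all blocks.
\<close>

lemma balance:
  assumes Y: "Y \<in> ktilings k (Suc T)" and t: "t \<ge> 0"
  shows "(\<Sum>X\<in>ktilings k T. wt k T t X * pmf (shuffle_step k t T X) Y) *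
      phi t k ^ card ({s \<in> aztec (Suc T). white (Suc T) s} - upper_right ` blocks (Suc T)) =
    wt k (Suc T) t Y"
proof -
  let ?B = "blocks (Suc T)"
  let ?C = "phi t k ^ card ({s \<in> aztec (Suc T). white (Suc T) s} - upper_right ` ?B)"
  let ?S = "{X \<in> ktilings k T. \<forall>a\<in>{1..k}. turned T (X a) (Y a)}"
  let ?q = "\<lambda>v. \<Prod>l\<in>{1..k}. creation_prob k t (\<lambda>a. state (Y a) v) l"
  let ?old = "\<lambda>v. \<Sum>f\<in>(\<Pi>\<^sub>E a\<in>{1..k}. turn (state (Y a) v)). t ^ pair_sum k (\<lambda>a b. energy_old (f a) (f b))"
  let ?new = "\<lambda>v. t ^ pair_sum k (\<lambda>a b. energy_new (state (Y a) v) (state (Y b) v))"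
  let ?H = "\<lambda>v. phi t (card {a \<in> {1..k}. state (Y a) v \<in> ll})"
  let ?K = "\<lambda>v. phi t (card {a \<in> {1..k}. state (Y a) v \<notin> ur})"
  have "(\<Sum>X\<in>ktilings k T. wt k T t X * pmf (shuffle_step k t T X) Y) =
      (\<Sum>X\<in>?S. wt k T t X * (\<Prod>v\<in>?B. ?q v))"
    by (rule sum.mono_neutral_cong_right) (auto simp: pmf_shuffle_step[OF _ Y t])
  also have "\<dots> = (\<Sum>X\<in>?S. wt k T t X) * (\<Prod>v\<in>?B. ?q v)"
    by (rule sum_distrib_right[symmetric])
  also have "(\<Sum>X\<in>?S. wt k T t X) =
      (\<Sum>X\<in>?S. \<Prod>v\<in>?B. t ^ pair_sum k (\<lambda>a b. energy_old (state (X a) v) (state (X b) v)))"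
    by (intro sum.cong refl wt_old) blast
  also have "\<dots> = (\<Prod>v\<in>?B. ?old v)"
    by (rule sum_over_sources[OF Y, of "\<lambda>v f. t ^ pair_sum k (\<lambda>a b. energy_old (f a) (f b))"])
      (rule arg_cong[of _ _ "power t"], rule pair_sum_cong, simp only:)
  finally have step: "(\<Sum>X\<in>ktilings k T. wt k T t X * pmf (shuffle_step k t T X) Y) =
      (\<Prod>v\<in>?B. ?old v) * (\<Prod>v\<in>?B. ?q v)" .
  have "(\<Prod>v\<in>?B. ?old v) * (\<Prod>v\<in>?B. ?q v) * (\<Prod>v\<in>?B. ?H v) = (\<Prod>v\<in>?B. ?new v) * (\<Prod>v\<in>?B. ?K v)"
    unfolding prod.distrib[symmetric] by (intro prod.cong refl local_balance t)
  then have "((\<Prod>v\<in>?B. ?old v) * (\<Prod>v\<in>?B. ?q v) * ?C) * (\<Prod>v\<in>?B. ?K v) = (\<Prod>v\<in>?B. ?new v) * (\<Prod>v\<in>?B. ?K v)"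
    unfolding phi_boundary[OF Y] mult.assoc .
  moreover have "(\<Prod>v\<in>?B. ?K v) \<noteq> 0"
    using phi_pos[OF t] by (simp add: less_imp_neq[symmetric])
  ultimately have "(\<Prod>v\<in>?B. ?old v) * (\<Prod>v\<in>?B. ?q v) * ?C = (\<Prod>v\<in>?B. ?new v)"
    by (simp only: mult_cancel_right simp_thms)
  then show ?thesis
    unfolding step wt_new[OF Y] .
qed

lemma aztec_0: "aztec 0 = {}"
proof -
  have "max (x + 1) (- x) \<ge> 1" for x :: int by (cases "x \<ge> 0") auto
  then have "(a, b) \<notin> aztec 0" for a b
    using add_mono[of 1 "max (a + 1) (- a)" 1 "max (b + 1) (- b)"] unfolding mem_aztec by fastforce
  then show ?thesis by auto
qed

lemma ktilings_0: "ktilings k 0 = {\<lambda>a\<in>{1..k}. {}}"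
proof -
  have "cells d \<noteq> {}" for d by (cases d) auto
  then have "tilings 0 = {{}}" by (auto simp: tilings_def aztec_0)
  moreover have "({1..k} \<rightarrow>\<^sub>E {{}}) = {\<lambda>a\<in>{1..k}. {} :: domino set}"
    by (auto simp: PiE_def extensional_def Pi_def fun_eq_iff)
  ultimately show ?thesis by (simp only: ktilings_def)
qed

lemma wt_0: "wt k 0 t X = 1"
  by (simp add: wt_def interactions_def aztec_0 case_prod_unfold)

theorem theorem1p2:
  fixes k N :: nat and t :: real
  assumes "k \<ge> 1" and "t \<ge> 0"
  shows "set_pmf (shuffle k t N) \<subseteq> ktilings k N \<and>
    (\<exists>c>0. \<forall>X\<in>ktilings k N. pmf (shuffle k t N) X = c * wt k N t X)"
proof (induction N)
  case 0
  have "set_pmf (return_pmf f) \<subseteq> {f} \<and> (\<exists>c>0. \<forall>X\<in>{f}. pmf (return_pmf f) X = c * (1 :: real))"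
    for f :: "nat \<Rightarrow> domino set"
    by (auto intro!: exI[of _ 1])
  then show ?case unfolding shuffle.simps ktilings_0 wt_0 .
next
  case (Suc T)
  then obtain c where c: "c > 0" "\<And>X. X \<in> ktilings k T \<Longrightarrow> pmf (shuffle k t T) X = c * wt k T t X"
    and supp: "set_pmf (shuffle k t T) \<subseteq> ktilings k T" by blast
  let ?r = "card ({s \<in> aztec (Suc T). white (Suc T) s} - upper_right ` blocks (Suc T))"
  have pos: "phi t k ^ ?r > 0" using phi_pos[OF assms(2)] by simp
  have "pmf (shuffle k t (Suc T)) Y = c / phi t k ^ ?r * wt k (Suc T) t Y" if Y: "Y \<in> ktilings k (Suc T)" for Y
  proof -
    have "pmf (shuffle k t (Suc T)) Y =
        (\<Sum>X\<in>ktilings k T. pmf (shuffle k t T) X *\<^sub>R pmf (shuffle_step k t T X) Y)"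
      unfolding shuffle.simps pmf_bind by (rule integral_measure_pmf) (use supp in auto)
    also have "\<dots> = c * (\<Sum>X\<in>ktilings k T. wt k T t X * pmf (shuffle_step k t T X) Y)"
      unfolding sum_distrib_left by (intro sum.cong refl) (simp add: c(2))
    also have "(\<Sum>X\<in>ktilings k T. wt k T t X * pmf (shuffle_step k t T X) Y) = wt k (Suc T) t Y / phi t k ^ ?r"
      by (rule eq_divide_imp[OF less_imp_neq[OF pos, THEN not_sym] balance[OF Y assms(2)]])
    finally show ?thesis by simp
  qed
  moreover have "set_pmf (shuffle k t (Suc T)) \<subseteq> ktilings k (Suc T)"
    using supp shuffle_step_support(1) by fastforce
  moreover have "c / phi t k ^ ?r > 0" using c(1) pos by simp
  ultimately show ?case by blast
qed

end
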